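(* Let $(G,\theta)$ be a $2$-oriented profinite group satisfying formal Hilbert 90 and let $\chi_1,\chi_2,\chi_3\in H^1(G,\mathbb Z/2\mathbb Z)$. If the mod $2$ Massey product $\langle\chi_1,\chi_2,\chi_3,\chi_1\rangle$ is defined, then it vanishes.
   Context: A $p$-oriented profinite group is a pair $(G,\theta)$ with $G$ a profinite group and $\theta\colon G\to\mathbb Z_p^\times$ a continuous homomorphism. For $n\geq 1$, $\mathbb Z/p^n\mathbb Z(1)$ denotes the discrete $G$-module $\mathbb Z/p^n\mathbb Z$ with $g\cdot v=\theta(g)v$. $(G,\theta)$ satisfies formal Hilbert 90 if for every open subgroup $H\subset G$ and every $n\geq1$ the reduction map $H^1(H,\mathbb Z/p^n\mathbb Z(1))\to H^1(H,\mathbb Z/p\mathbb Z(1))$ is surjective. Here $p=2$ and $\mathbb Z/2\mathbb Z$ has trivial action. Massey products: For a differential graded ring $(A,\partial)$ and $a_1,\dots,a_n\in H^1(A)$, a defining system for $\langle a_1,\dots,a_n\rangle$ is a collection of elements $a_{ij}\in A^1$, $1\le i<j\le n+1$, $(i,j)\ne(1,n+1)$, with $\partial a_{i,i+1}=0$, $a_{i,i+1}$ representing $a_i$, and $\partial(a_{ij})=-\sum_{l=i+1}^{j-1}a_{il}a_{lj}$ for $i<j-1$; its value is the class of $-\sum_{l=2}^n a_{1l}a_{l,n+1}$ in $H^2(A)$. The Massey product $\langle a_1,\dots,a_n\rangle\subset H^2(A)$ is the set of all values of defining systems; it is defined if nonempty and vanishes if it contains $0$. Mod $2$ Massey products for $G$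 are taken in the differential graded ring of continuous inhomogeneous cochains $C^*(G,\mathbb Z/2\mathbb Z)$ with cup product. *)

theory Defs
  imports "HOL-Analysis.Analysis" "HOL-Algebra.Group" "HOL-Library.Z2"
begin

definition profinite_group :: "('a, 'b) monoid_scheme \<Rightarrow> 'a topology \<Rightarrow> bool" where
  "profinite_group G T \<longleftrightarrow>
     group G \<and> topspace T = carrier G \<and> compact_space T \<and> Hausdorff_space T \<and>
     (\<forall>x\<in>carrier G. connected_component_of_set T x = {x}) \<and>
     continuous_map (prod_topology T T) T (\<lambda>(x, y). x \<otimes>\<^bsub>G\<^esub> y) \<and>
     continuous_map T T (\<lambda>x. inv\<^bsub>G\<^esub> x)"

text \<open>A p-adic integer is encoded by its compatible system of residues x n in [0, p^n);
  it is a unit iff its residue mod p is nonzero.\<close>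
definition zp_unit :: "int \<Rightarrow> (nat \<Rightarrow> int) \<Rightarrow> bool" where
  "zp_unit p x \<longleftrightarrow> (\<forall>n. 0 \<le> x n \<and> x n < p ^ n \<and> x (Suc n) mod p ^ n = x n) \<and> \<not> p dvd x 1"

text \<open>A continuous homomorphism theta : G -> Z_p^x; continuity for the p-adic (= inverse limit)
  topology means every residue map g |-> theta g n is locally constant.\<close>
definition p_orientation ::
  "int \<Rightarrow> ('a, 'b) monoid_scheme \<Rightarrow> 'a topology \<Rightarrow> ('a \<Rightarrow> nat \<Rightarrow> int) \<Rightarrow> bool" where
  "p_orientation p G T \<theta> \<longleftrightarrow>
     (\<forall>g\<in>carrier G. zp_unit p (\<theta> g)) \<and>
     (\<forall>g\<in>carrier G. \<forall>h\<in>carrier G. \<forall>n. \<theta> (g \<otimes>\<^bsub>G\<^esub> h) n = (\<theta> g n * \<theta> h n) mod p ^ n) \<and>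
     (\<forall>n v. openin T {g \<in> carrier G. \<theta> g n = v})"

text \<open>Continuous inhomogeneous 1-cocycles H -> Z/p^n(1) (values represented in [0,p^n)):
  c(gh) = c(g) + theta(g) c(h).  Continuity = local constancy (H is open in G).\<close>
definition tw_cocycle1 ::
  "int \<Rightarrow> ('a, 'b) monoid_scheme \<Rightarrow> 'a topology \<Rightarrow> ('a \<Rightarrow> nat \<Rightarrow> int) \<Rightarrow> 'a set \<Rightarrow> nat
    \<Rightarrow> ('a \<Rightarrow> int) \<Rightarrow> bool" where
  "tw_cocycle1 p G T \<theta> H n c \<longleftrightarrow>
     (\<forall>h\<in>H. 0 \<le> c h \<and> c h < p ^ n) \<and>
     (\<forall>g\<in>H. \<forall>h\<in>H. c (g \<otimes>\<^bsub>G\<^esub> h) = (c g + \<theta> g n * c h) mod p ^ n) \<and>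
     (\<forall>v. openin T {h \<in> H. c h = v})"

definition tw_cohomologous1 ::
  "int \<Rightarrow> ('a \<Rightarrow> nat \<Rightarrow> int) \<Rightarrow> 'a set \<Rightarrow> nat \<Rightarrow> ('a \<Rightarrow> int) \<Rightarrow> ('a \<Rightarrow> int) \<Rightarrow> bool" where
  "tw_cohomologous1 p \<theta> H n c c' \<longleftrightarrow>
     (\<exists>a::int. \<forall>h\<in>H. c h mod p ^ n = (c' h + \<theta> h n * a - a) mod p ^ n)"

definition formal_hilbert90 ::
  "int \<Rightarrow> ('a, 'b) monoid_scheme \<Rightarrow> 'a topology \<Rightarrow> ('a \<Rightarrow> nat \<Rightarrow> int) \<Rightarrow> bool" where
  "formal_hilbert90 p G T \<theta> \<longleftrightarrow>
     (\<forall>H. subgroup H G \<and> openin T H \<longrightarrow>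
       (\<forall>n\<ge>1. \<forall>c1. tw_cocycle1 p G T \<theta> H 1 c1 \<longrightarrow>
          (\<exists>c. tw_cocycle1 p G T \<theta> H n c \<and>
               tw_cohomologous1 p \<theta> H 1 (\<lambda>h. c h mod p) c1)))"

definition cochain1 :: "'a topology \<Rightarrow> ('a \<Rightarrow> bit) \<Rightarrow> bool" where
  "cochain1 T a \<longleftrightarrow> continuous_map T (discrete_topology UNIV) a"

text \<open>Inhomogeneous differentials C^0 -> C^1 and C^1 -> C^2 (trivial action).\<close>
definition d0 :: "bit \<Rightarrow> 'a \<Rightarrow> bit" where
  "d0 c g = c - c"

definition d1 :: "('a, 'b) monoid_scheme \<Rightarrow> ('a \<Rightarrow> bit) \<Rightarrow> 'a \<Rightarrow> 'a \<Rightarrow> bit" where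
  "d1 G a g h = a h - a (g \<otimes>\<^bsub>G\<^esub> h) + a g"

definition cup11 :: "('a \<Rightarrow> bit) \<Rightarrow> ('a \<Rightarrow> bit) \<Rightarrow> 'a \<Rightarrow> 'a \<Rightarrow> bit" where
  "cup11 a b g h = a g * b h"

definition cocycle1 :: "('a, 'b) monoid_scheme \<Rightarrow> 'a topology \<Rightarrow> ('a \<Rightarrow> bit) \<Rightarrow> bool" where
  "cocycle1 G T a \<longleftrightarrow> cochain1 T a \<and> (\<forall>g\<in>carrier G. \<forall>h\<in>carrier G. d1 G a g h = 0)"

definition massey_defining_system ::
  "('a, 'b) monoid_scheme \<Rightarrow> 'a topology \<Rightarrow> ('a \<Rightarrow> bit) list \<Rightarrow> (nat \<Rightarrow> nat \<Rightarrow> 'a \<Rightarrow> bit) \<Rightarrow> bool" where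
  "massey_defining_system G T xs A \<longleftrightarrow>
     (\<forall>i j. 1 \<le> i \<and> i < j \<and> j \<le> length xs + 1 \<and> (i, j) \<noteq> (1, length xs + 1) \<longrightarrow>
        cochain1 T (A i j) \<and>
        (j = Suc i \<longrightarrow>
           (\<forall>g\<in>carrier G. \<forall>h\<in>carrier G. d1 G (A i j) g h = 0) \<and>
           (\<exists>c. \<forall>g\<in>carrier G. A i j g - (xs ! (i - 1)) g = d0 c g)) \<and>
        (Suc i < j \<longrightarrow>
           (\<forall>g\<in>carrier G. \<forall>h\<in>carrier G.
              d1 G (A i j) g h = - (\<Sum>l\<in>{i+1..j-1}. cup11 (A i l) (A l j) g h))))"

definition massey_value :: "nat \<Rightarrow> (nat \<Rightarrow> nat \<Rightarrow> 'a \<Rightarrow> bit) \<Rightarrow> 'a \<Rightarrow> 'a \<Rightarrow> bit" where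
  "massey_value n A g h = - (\<Sum>l\<in>{2..n}. cup11 (A 1 l) (A l (n + 1)) g h)"

definition massey_defined ::
  "('a, 'b) monoid_scheme \<Rightarrow> 'a topology \<Rightarrow> ('a \<Rightarrow> bit) list \<Rightarrow> bool" where
  "massey_defined G T xs \<longleftrightarrow> (\<exists>A. massey_defining_system G T xs A)"

definition massey_vanishes ::
  "('a, 'b) monoid_scheme \<Rightarrow> 'a topology \<Rightarrow> ('a \<Rightarrow> bit) list \<Rightarrow> bool" where
  "massey_vanishes G T xs \<longleftrightarrow>
     (\<exists>A. massey_defining_system G T xs A \<and>
        (\<exists>b. cochain1 T b \<and>
           (\<forall>g\<in>carrier G. \<forall>h\<in>carrier G. massey_value (length xs) A g h = d1 G b g h)))"

end

theory Submission
  imports Defs "HOL-Number_Theory.Cong"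
begin

text \<open>
  Write a, b, c for the three characters and N for the kernel of a. A defining system contains
  cochains p, q with coboundaries ab and ca, and since the products ab, bc, ca vanish compatibly,
  a Jacobi identity for Massey products yields a class i on the common kernel of b and c with
  partial corestrictions p and q and total corestriction a. The value of the product vanishes modulo
  the multiples of a as soon as it vanishes on N, where it is the cup product of p and q. The claim
  is that (p + X)(q + b + e) = 0 on N for a suitable character X with cX = 0, where e is the
  character of -1, i.e. the reduction of \<theta> modulo 4.

  Formal Hilbert 90 lifts i to Z/8(1), with corestriction Q lifting q on the kernel K of c. In terms
  of Kummer theory, on K the class q is the norm of i, and it is also the norm of a square root of
  -q; so on the subgroup L of K on which b = q + e, the quotient of i by this square root has norm 1,
  which forces its cup product with b to vanish. Descending from L to K this gives r on K with
  b sqrt(-q) + i(q + e) = (b + q + e) r, and the transfer of this relation from K to N reads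
  b sqrt(a) + p(q + e) = (b + q + e) X with X the corestriction of r. Since b sqrt(a) = bp and
  bq = 0 on N, this is the claim. The required modification of the defining system replaces p by
  p + X and q by q + b + e.
\<close>

section \<open>Bits and integers\<close>

declare add_bit_eq_xor [simp del] mult_bit_eq_and [simp del]

text \<open>The binary digit of weight 2, which depends only on the residue modulo 4. Applied to a
  cocycle with values in Z/4 it gives a cochain whose coboundary describes the Bockstein of the
  reduction modulo 2.\<close>

definition hi :: "int \<Rightarrow> bit" where
  "hi x = of_int (x div 2)"

definition int_of_bit :: "bit \<Rightarrow> int" where
  "int_of_bit x = (if x = 0 then 0 else 1)"

lemma of_int_int_of_bit [simp]: "of_int (int_of_bit x) = x"
  by (simp add: int_of_bit_def)

lemma of_int_bit_eq: "(of_int x :: bit) = (if even x then 0 else 1)"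
  by (cases "even x") (auto elim!: evenE oddE)

lemma of_int_bit_cong: "[x = y] (mod 2) \<Longrightarrow> (of_int x :: bit) = of_int y"
  by (auto simp: of_int_bit_eq cong_def even_iff_mod_2_eq_zero)

lemma hi_cong: "[x = y] (mod 4) \<Longrightarrow> hi x = hi y"
proof -
  have "even (z div 2) \<longleftrightarrow> z mod 4 < 2" for z :: int by presburger
  then show "[x = y] (mod 4) \<Longrightarrow> hi x = hi y" by (simp add: hi_def of_int_bit_eq cong_def)
qed

lemma bit_add_self: "x + x = (0::bit)"
  by (cases x) auto

lemma bit_add_left_self: "x + (x + y) = (y::bit)"
  by (cases x) auto

lemma bit_mult_self: "x * x = (x::bit)"
  by (cases x) auto

lemma bit_mult_left_self: "x * (x * y) = x * (y::bit)"
  by (cases x) auto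

lemma bit_minus: "x - y = x + (y::bit)"
  by (cases y) auto

lemma bit_add_eq_0: "x + y = 0 \<longleftrightarrow> x = (y :: bit)"
  by (cases x; cases y) auto

lemma bit_sum4_eq_0: "a + b + c + d = (0::bit) \<Longrightarrow> a = b + c + d"
  by (cases a; cases b; cases c; cases d) auto

text \<open>Together with the laws of a commutative ring, \<open>x + x = 0\<close> and
  \<open>x * x = x\<close> bring polynomial functions of bits into a normal form, so that identities
  between cochains are settled by rewriting.\<close>

lemmas bit_ring = algebra_simps add_0_left add_0_right mult_zero_left mult_zero_right
  mult_1_left mult_1_right bit_add_self bit_add_left_self bit_mult_self bit_mult_left_self

lemma bit_cancel:
  "p + x + r = (q :: bit) \<Longrightarrow> x = p + r + q"
  by (auto simp only: bit_ring)

text \<open>The product term is the carry from the units digit.\<close>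

lemma hi_add: "hi (x + y) = hi x + hi y + of_int x * of_int y"
proof -
  have "(x + y) div 2 = x div 2 + y div 2 + (if odd x \<and> odd y then 1 else 0)"
    by presburger
  then show ?thesis by (auto simp: hi_def of_int_bit_eq)
qed

text \<open>Modulo 4 the product of \<open>2 * h + r\<close> and \<open>2 * k + s\<close> is
  \<open>2 * (h * s + r * k) + r * s\<close>, and \<open>r * s\<close> is at most 1, so no carry
  occurs.\<close>

lemma hi_mult: "hi (x * y) = hi x * of_int y + of_int x * hi y"
proof -
  define h k r s where "h = x div 2" and "k = y div 2" and "r = x mod 2" and "s = y mod 2"
  have x: "x = 2 * h + r" and y: "y = 2 * k + s" and rs: "r = 0 \<or> r = 1" "s = 0 \<or> s = 1"
    unfolding h_def k_def r_def s_def by auto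
  have "x * y = 2 * (2 * h * k + h * s + r * k) + r * s"
    by (simp add: x y algebra_simps)
  moreover have "0 \<le> r * s" "r * s < 2" using rs by auto
  ultimately have "(x * y) div 2 = 2 * h * k + h * s + r * k" by presburger
  moreover have "(of_int y :: bit) = of_int s" "(of_int x :: bit) = of_int r" by (simp_all add: x y)
  ultimately show ?thesis by (simp add: hi_def flip: h_def k_def)
qed

lemma hi_uminus: "hi (- x) = hi x + of_int x"
proof -
  have "hi (-1) = 1" by (simp add: hi_def)
  with hi_mult[of "-1" x] show ?thesis by (cases "(of_int x :: bit)"; cases "hi x") auto
qed

section \<open>Locally constant functions\<close>

text \<open>Continuity for the discrete topology on the target. As \<open>H\<close> is the union of
  the fibres, the condition also makes \<open>H\<close> open; later proofs extract this with a
  constantly true predicate.\<close>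

definition locally_const :: "'a topology \<Rightarrow> 'a set \<Rightarrow> ('a \<Rightarrow> 'c) \<Rightarrow> bool" where
  "locally_const T H f \<longleftrightarrow> (\<forall>v. openin T {h \<in> H. f h = v})"

lemma locally_const_openin: "locally_const T H f \<Longrightarrow> openin T {h \<in> H. P (f h)}"
proof -
  assume f: "locally_const T H f"
  have "{h \<in> H. P (f h)} = (\<Union>v\<in>{v. P v}. {h \<in> H. f h = v})" by auto
  with f show ?thesis by (auto simp: locally_const_def)
qed

lemma locally_const_const:
  assumes "openin T H"
  shows "locally_const T H (\<lambda>_. c)"
  unfolding locally_const_def
proof
  fix v
  show "openin T {h \<in> H. c = v}" using assms by (cases "c = v") auto
qed

lemma locally_const_comp: "locally_const T H f \<Longrightarrow> locally_const T H (\<lambda>x. F (f x))"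
  using locally_const_openin[of T H f "\<lambda>y. F y = v" for v] by (simp add: locally_const_def)

lemma locally_const_comp2:
  assumes f: "locally_const T H f" and g: "locally_const T H g"
  shows "locally_const T H (\<lambda>x. F (f x) (g x))"
  unfolding locally_const_def
proof
  fix v
  have "{h \<in> H. F (f h) (g h) = v} = (\<Union>u. {h \<in> H. f h = u} \<inter> {h \<in> H. F u (g h) = v})" by auto
  also have "openin T \<dots>"
    using f locally_const_openin[OF g, of "\<lambda>y. F u y = v" for u]
    by (intro openin_Union) (auto simp: locally_const_def)
  finally show "openin T {h \<in> H. F (f h) (g h) = v}" .
qed

lemma locally_const_pieces:
  assumes "\<And>u. locally_const T {h \<in> H. w h = u} f"
  shows "locally_const T H f"
  unfolding locally_const_def
proof
  fix v
  have "{h \<in> H. f h = v} = (\<Union>u. {h \<in> {h \<in> H. w h = u}. f h = v})" by auto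
  also have "openin T \<dots>" using assms by (intro openin_Union) (auto simp: locally_const_def)
  finally show "openin T {h \<in> H. f h = v}" .
qed

lemma locally_const_subset:
  assumes "locally_const T H f" "openin T H'" "H' \<subseteq> H"
  shows "locally_const T H' f"
  unfolding locally_const_def
proof
  fix v
  have "{h \<in> H'. f h = v} = H' \<inter> {h \<in> H. f h = v}" using assms(3) by auto
  then show "openin T {h \<in> H'. f h = v}" using assms by (auto simp: locally_const_def)
qed

lemma locally_const_cong:
  assumes "locally_const T H f" "\<And>x. x \<in> H \<Longrightarrow> f x = g x"
  shows "locally_const T H g"
proof -
  have "{h \<in> H. g h = v} = {h \<in> H. f h = v}" for v using assms(2) by auto
  with assms(1) show ?thesis by (simp add: locally_const_def)
qed

lemma locally_const_bit_arith:
  fixes f g :: "'a \<Rightarrow> bit"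
  assumes "locally_const T H f" "locally_const T H g"
  shows "locally_const T H (\<lambda>x. f x + g x)" "locally_const T H (\<lambda>x. f x * g x)"
  using locally_const_comp2[OF assms] by auto

lemma cochain1_iff: "cochain1 T a \<longleftrightarrow> locally_const T (topspace T) a"
proof
  assume "cochain1 T a"
  then show "locally_const T (topspace T) a"
    using openin_continuous_map_preimage[of T "discrete_topology UNIV" a "{v}" for v]
    by (auto simp: cochain1_def locally_const_def)
next
  assume "locally_const T (topspace T) a"
  then show "cochain1 T a"
    using locally_const_openin[of T "topspace T" a "\<lambda>y. y \<in> U" for U]
    by (auto simp: cochain1_def continuous_map_def)
qed

section \<open>Shapiro's lemma in low degrees\<close>

locale top_group = group G for G :: "('a, 'b) monoid_scheme" (structure) +
  fixes T :: "'a topology"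
  assumes topspace: "topspace T = carrier G"
    and mult_cont: "continuous_map (prod_topology T T) T (\<lambda>(x, y). x \<otimes> y)"
begin

lemma openin_carrier: "openin T (carrier G)"
  using openin_topspace[of T] by (simp add: topspace)

lemma continuous_left: "x \<in> carrier G \<Longrightarrow> continuous_map T T (\<lambda>g. x \<otimes> g)"
proof -
  assume x: "x \<in> carrier G"
  then have "continuous_map T (prod_topology T T) (\<lambda>g. (x, g))"
    by (simp add: continuous_map_pairwise o_def topspace)
  from continuous_map_compose[OF this mult_cont] show ?thesis by (simp add: o_def)
qed

lemma continuous_right: "x \<in> carrier G \<Longrightarrow> continuous_map T T (\<lambda>g. g \<otimes> x)"
proof -
  assume x: "x \<in> carrier G"
  then have "continuous_map T (prod_topology T T) (\<lambda>g. (g, x))"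
    by (simp add: continuous_map_pairwise o_def topspace)
  from continuous_map_compose[OF this mult_cont] show ?thesis by (simp add: o_def)
qed

lemma locally_const_left:
  assumes "locally_const T H f" "x \<in> carrier G"
  shows "locally_const T {g \<in> carrier G. x \<otimes> g \<in> H} (\<lambda>g. f (x \<otimes> g))"
  unfolding locally_const_def
proof
  fix v
  have "openin T {g \<in> topspace T. x \<otimes> g \<in> {h \<in> H. f h = v}}"
    using assms by (intro openin_continuous_map_preimage[OF continuous_left])
      (auto simp: locally_const_def)
  then show "openin T {h \<in> {g \<in> carrier G. x \<otimes> g \<in> H}. f (x \<otimes> h) = v}"
    by (simp add: topspace conj_assoc)
qed

lemma locally_const_right:
  assumes "locally_const T H f" "x \<in> carrier G"
  shows "locally_const T {g \<in> carrier G. g \<otimes> x \<in> H} (\<lambda>g. f (g \<otimes> x))"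
  unfolding locally_const_def
proof
  fix v
  have "openin T {g \<in> topspace T. g \<otimes> x \<in> {h \<in> H. f h = v}}"
    using assms by (intro openin_continuous_map_preimage[OF continuous_right])
      (auto simp: locally_const_def)
  then show "openin T {h \<in> {g \<in> carrier G. g \<otimes> x \<in> H}. f (h \<otimes> x) = v}"
    by (simp add: topspace conj_assoc)
qed

lemma locally_const_subgroup_left:
  assumes "subgroup H G" "locally_const T H f" "x \<in> H"
  shows "locally_const T H (\<lambda>g. f (x \<otimes> g))"
proof -
  have x: "x \<in> carrier G" using assms subgroup.mem_carrier by metis
  have "openin T H" using locally_const_openin[OF assms(2), of "\<lambda>_. True"] by simp
  moreover have "H \<subseteq> {g \<in> carrier G. x \<otimes> g \<in> H}"
    using assms by (auto intro: subgroup.mem_carrier subgroup.m_closed)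
  ultimately show ?thesis
    using locally_const_subset[OF locally_const_left[OF assms(2) x]] by blast
qed

lemma kernel_subgroup:
  fixes w :: "'a \<Rightarrow> 'v::ab_group_add"
  assumes H: "subgroup H G" and hom: "\<And>g h. g \<in> H \<Longrightarrow> h \<in> H \<Longrightarrow> w (g \<otimes> h) = w g + w h"
  shows "subgroup {g \<in> H. w g = 0} G"
proof
  interpret H: subgroup H G by fact
  have one: "w \<one> = 0" using hom[of \<one> \<one>] by simp
  show "{g \<in> H. w g = 0} \<subseteq> carrier G" by auto
  show "\<one> \<in> {g \<in> H. w g = 0}" using one by simp
  show "x \<otimes> y \<in> {g \<in> H. w g = 0}" if "x \<in> {g \<in> H. w g = 0}" "y \<in> {g \<in> H. w g = 0}" for x y
    using that hom by simp
  show "inv x \<in> {g \<in> H. w g = 0}" if "x \<in> {g \<in> H. w g = 0}" for x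
    using that hom[of x "inv x"] one by (simp add: H.mem_carrier)
qed

text \<open>Cochains with values in the module coinduced from the kernel of w are encoded as families
  indexed by the values of w, on which a group element g acts by the shift by \<open>w g\<close>.\<close>

lemma shapiro_degree2:
  fixes w :: "'a \<Rightarrow> bit" and Y :: "bit \<Rightarrow> 'a \<Rightarrow> 'a \<Rightarrow> bit"
  assumes H: "subgroup H G"
    and w_lc: "locally_const T H w"
    and w_hom: "\<And>g h. g \<in> H \<Longrightarrow> h \<in> H \<Longrightarrow> w (g \<otimes> h) = w g + w h"
    and t: "t \<in> H" "w t = 1"
    and cocycle: "\<And>\<gamma> g h k. g \<in> H \<Longrightarrow> h \<in> H \<Longrightarrow> k \<in> H \<Longrightarrow>
      Y (\<gamma> + w g) h k + Y \<gamma> (g \<otimes> h) k + Y \<gamma> g (h \<otimes> k) + Y \<gamma> g h = 0"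
    and Y_lc: "\<And>x. x \<in> H \<Longrightarrow> locally_const T H (\<lambda>g. Y 0 g x)"
      "\<And>x. x \<in> H \<Longrightarrow> locally_const T H (\<lambda>g. Y 0 x g)"
    and \<mu>_lc: "locally_const T {g \<in> H. w g = 0} \<mu>"
    and \<mu>: "\<And>g h. g \<in> H \<Longrightarrow> h \<in> H \<Longrightarrow> w g = 0 \<Longrightarrow> w h = 0 \<Longrightarrow>
      Y 0 g h = \<mu> h + \<mu> (g \<otimes> h) + \<mu> g"
  shows "\<exists>m. (\<forall>\<gamma>. locally_const T H (m \<gamma>)) \<and>
    (\<forall>\<gamma>. \<forall>g\<in>H. \<forall>h\<in>H. Y \<gamma> g h = m (\<gamma> + w g) h + m \<gamma> (g \<otimes> h) + m \<gamma> g) \<and>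
    (\<forall>g\<in>H. w g = 0 \<longrightarrow> m 0 g = \<mu> g)"
proof -
  interpret H: subgroup H G by fact
  have w_one: "w \<one> = 0" using w_hom[of \<one> \<one>] by simp
  have w_inv: "w (inv t) = 1"
    using w_hom[of t "inv t"] t w_one by (cases "w (inv t)") (auto simp: H.mem_carrier)
  \<comment> \<open>An element of \<open>H\<close> outside the kernel is
    \<open>k \<otimes> t\<close> with \<open>k\<close> in the kernel. If the primitive is normalized
    to vanish at \<open>t\<close>, the coboundary equation at (k, t) determines \<open>m0\<close>
    and the one at (t, h) determines \<open>m1\<close>.\<close>
  define m0 where "m0 g = (if w g = 0 then \<mu> g else \<mu> (g \<otimes> inv t) + Y 0 (g \<otimes> inv t) t)" for g
  define m1 where "m1 h = Y 0 t h + m0 (t \<otimes> h) + m0 t" for h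
  define m where "m \<gamma> = (if \<gamma> = 0 then m0 else m1)" for \<gamma> :: bit
  have split: "\<exists>k\<in>H. w k = 0 \<and> g = k \<otimes> t" if "g \<in> H" "w g = 1" for g
    using that t w_inv w_hom[of g "inv t"]
    by (intro bexI[of _ "g \<otimes> inv t"]) (auto simp: H.mem_carrier m_assoc)
  have m0_t: "m0 (k \<otimes> t) = \<mu> k + Y 0 k t" if "k \<in> H" "w k = 0" for k
    using that t w_hom[of k t] by (auto simp: m0_def H.mem_carrier m_assoc)
  \<comment> \<open>The coboundary equation with first argument in the kernel, by the cocycle
    identity at (k, k', t). The identities at (k, t, h) and (t, g, h) then extend it to all
    arguments and to the component 1.\<close>
  have A: "Y 0 k g = m0 g + m0 (k \<otimes> g) + m0 k" if k: "k \<in> H" "w k = 0" and g: "g \<in> H" for k g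
  proof (cases "w g = 0")
    case True
    then show ?thesis using that w_hom[of k g] \<mu>[of k g] by (simp add: m0_def)
  next
    case False
    then obtain k' where k': "k' \<in> H" "w k' = 0" "g = k' \<otimes> t" using split g by auto
    have "Y 0 k g + Y 0 k k' + Y 0 k' t + Y 0 (k \<otimes> k') t = 0"
      using cocycle[of k k' t 0] k k' t by (simp add: add_ac)
    then have "Y 0 k g = Y 0 k k' + Y 0 k' t + Y 0 (k \<otimes> k') t"
      by (rule bit_sum4_eq_0)
    moreover have "Y 0 k k' = \<mu> k' + \<mu> (k \<otimes> k') + \<mu> k" using \<mu> k k' by simp
    moreover have "m0 (k \<otimes> g) = \<mu> (k \<otimes> k') + Y 0 (k \<otimes> k') t"
      using m0_t[of "k \<otimes> k'"] k k' t w_hom[of k k'] by (simp add: H.mem_carrier m_assoc)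
    moreover have "m0 g = \<mu> k' + Y 0 k' t" "m0 k = \<mu> k" using m0_t k k' by (auto simp: m0_def)
    ultimately show ?thesis by (simp only: bit_ring)
  qed
  have B: "Y 0 t h = m1 h + m0 (t \<otimes> h) + m0 t" for h
    by (simp add: m1_def bit_ring)
  have C0: "Y 0 g h = m (w g) h + m0 (g \<otimes> h) + m0 g" if g: "g \<in> H" and h: "h \<in> H" for g h
  proof (cases "w g = 0")
    case True
    then show ?thesis using A that by (simp add: m_def)
  next
    case False
    then obtain k where k: "k \<in> H" "w k = 0" "g = k \<otimes> t" using split g by auto
    have "Y 0 g h + Y 0 t h + Y 0 k (t \<otimes> h) + Y 0 k t = 0"
      using cocycle[of k t h 0] k t h by (simp add: add_ac)
    then have "Y 0 g h = Y 0 t h + Y 0 k (t \<otimes> h) + Y 0 k t"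
      by (rule bit_sum4_eq_0)
    moreover have "Y 0 k (t \<otimes> h) = m0 (t \<otimes> h) + m0 (g \<otimes> h) + m0 k"
      using A[of k "t \<otimes> h"] k t h by (simp add: H.mem_carrier m_assoc)
    moreover have "Y 0 k t = m0 t + m0 g + m0 k" using A[of k t] k t by simp
    moreover have "m (w g) h = m1 h" using False by (simp add: m_def)
    ultimately show ?thesis by (simp only: B bit_ring)
  qed
  have C1: "Y 1 g h = m (1 + w g) h + m1 (g \<otimes> h) + m1 g" if g: "g \<in> H" and h: "h \<in> H" for g h
  proof -
    have "Y 1 g h + Y 0 (t \<otimes> g) h + Y 0 t (g \<otimes> h) + Y 0 t g = 0"
      using cocycle[of t g h 0] t g h by simp
    then have "Y 1 g h = Y 0 (t \<otimes> g) h + Y 0 t (g \<otimes> h) + Y 0 t g"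
      by (rule bit_sum4_eq_0)
    moreover have "Y 0 (t \<otimes> g) h = m (1 + w g) h + m0 (t \<otimes> (g \<otimes> h)) + m0 (t \<otimes> g)"
      using C0[of "t \<otimes> g" h] w_hom[of t g] t g h by (simp add: H.mem_carrier m_assoc)
    ultimately show ?thesis by (simp only: B bit_ring)
  qed
  have H_open: "openin T H" using locally_const_openin[OF w_lc, of "\<lambda>_. True"] by simp
  have m0_lc: "locally_const T H m0"
  proof (rule locally_const_pieces[where w = w])
    fix u :: bit
    have op: "openin T {h \<in> H. w h = u}" using w_lc by (simp add: locally_const_def)
    show "locally_const T {h \<in> H. w h = u} m0"
    proof (cases "u = 0")
      case True
      show ?thesis using \<mu>_lc unfolding True by (rule locally_const_cong) (simp add: m0_def)
    next
      case False
      have it: "inv t \<in> H" using t by simp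
      have "locally_const T {g \<in> H. w g = 0} (\<lambda>g. \<mu> g + Y 0 g t)"
        using locally_const_subset[OF Y_lc(1)[OF t(1)], of "{g \<in> H. w g = 0}"] w_lc \<mu>_lc
        by (intro locally_const_bit_arith) (auto simp: locally_const_def)
      from locally_const_right[OF this, of "inv t"]
      have lc: "locally_const T {g \<in> carrier G. g \<otimes> inv t \<in> {g \<in> H. w g = 0}}
          (\<lambda>g. \<mu> (g \<otimes> inv t) + Y 0 (g \<otimes> inv t) t)" using t by (simp add: H.mem_carrier)
      have sub: "{h \<in> H. w h = u} \<subseteq> {g \<in> carrier G. g \<otimes> inv t \<in> {g \<in> H. w g = 0}}"
      proof
        fix g
        assume "g \<in> {h \<in> H. w h = u}"
        with False have "g \<in> H" "w g = 1" by auto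
        then show "g \<in> {g \<in> carrier G. g \<otimes> inv t \<in> {g \<in> H. w g = 0}}"
          using it w_inv w_hom[of g "inv t"] by (simp add: H.mem_carrier)
      qed
      from locally_const_subset[OF lc op sub] show ?thesis by (rule locally_const_cong) (use False in \<open>auto simp: m0_def\<close>)
    qed
  qed
  have "locally_const T H m1"
    unfolding m1_def
    using Y_lc(2)[OF t(1)] locally_const_subgroup_left[OF H m0_lc t(1)] locally_const_const[OF H_open]
    by (intro locally_const_bit_arith)
  with m0_lc have m_lc: "locally_const T H (m \<gamma>)" for \<gamma> by (simp add: m_def)
  have Y_m: "Y \<gamma> g h = m (\<gamma> + w g) h + m \<gamma> (g \<otimes> h) + m \<gamma> g"
    if "g \<in> H" "h \<in> H" for \<gamma> g h
    using C0[OF that] C1[OF that] by (cases \<gamma>) (auto simp: m_def)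
  show ?thesis
  proof (intro exI[of _ m] conjI allI ballI impI)
    show "locally_const T H (m \<gamma>)" for \<gamma> by (rule m_lc)
    show "Y \<gamma> g h = m (\<gamma> + w g) h + m \<gamma> (g \<otimes> h) + m \<gamma> g" if "g \<in> H" "h \<in> H" for \<gamma> g h
      using that by (rule Y_m)
    show "m 0 g = \<mu> g" if "g \<in> H" "w g = 0" for g using that by (simp add: m_def m0_def)
  qed
qed

text \<open>A class that dies on the kernel of \<open>w\<close> is a cup product with
  \<open>w\<close>. Shapiro's lemma for the constant family \<open>Y\<close> gives cochains
  \<open>m 0\<close> and \<open>m 1\<close>; comparing the two components of the equation shows that
  their sum \<open>r\<close> is a character, and \<open>m (w g)\<close> is \<open>m 0\<close> plus
  \<open>w g\<close> times \<open>r\<close>. If \<open>w\<close> is trivial on \<open>H\<close>,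
  then \<open>\<mu>\<close> is already a primitive and \<open>r = 0\<close> will do.\<close>

lemma kernel_coboundary:
  fixes w :: "'a \<Rightarrow> bit" and Y :: "'a \<Rightarrow> 'a \<Rightarrow> bit"
  assumes H: "subgroup H G"
    and w_lc: "locally_const T H w"
    and w_hom: "\<And>g h. g \<in> H \<Longrightarrow> h \<in> H \<Longrightarrow> w (g \<otimes> h) = w g + w h"
    and cocycle: "\<And>g h k. g \<in> H \<Longrightarrow> h \<in> H \<Longrightarrow> k \<in> H \<Longrightarrow>
      Y h k + Y (g \<otimes> h) k + Y g (h \<otimes> k) + Y g h = 0"
    and Y_lc: "\<And>x. x \<in> H \<Longrightarrow> locally_const T H (\<lambda>g. Y g x)"
      "\<And>x. x \<in> H \<Longrightarrow> locally_const T H (\<lambda>g. Y x g)"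
    and \<mu>_lc: "locally_const T {g \<in> H. w g = 0} \<mu>"
    and \<mu>: "\<And>g h. g \<in> H \<Longrightarrow> h \<in> H \<Longrightarrow> w g = 0 \<Longrightarrow> w h = 0 \<Longrightarrow>
      Y g h = \<mu> h + \<mu> (g \<otimes> h) + \<mu> g"
  shows "\<exists>m r. locally_const T H m \<and> locally_const T H r \<and>
    (\<forall>g\<in>H. \<forall>h\<in>H. r (g \<otimes> h) = r g + r h) \<and>
    (\<forall>g\<in>H. \<forall>h\<in>H. Y g h + w g * r h = m h + m (g \<otimes> h) + m g)"
proof (cases "\<exists>t\<in>H. w t = 1")
  case True
  then obtain t where t: "t \<in> H" "w t = 1" by blast
  have "\<exists>m. (\<forall>\<gamma>. locally_const T H (m \<gamma>)) \<and>
    (\<forall>\<gamma>. \<forall>g\<in>H. \<forall>h\<in>H. Y g h = m (\<gamma> + w g) h + m \<gamma> (g \<otimes> h) + m \<gamma> g) \<and>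
    (\<forall>g\<in>H. w g = 0 \<longrightarrow> m 0 g = \<mu> g)"
    by (rule shapiro_degree2[OF H w_lc w_hom t]) (assumption | rule cocycle Y_lc \<mu>_lc \<mu>)+
  then obtain m where m': "\<forall>\<gamma>. locally_const T H (m \<gamma>)"
    "\<forall>\<gamma>. \<forall>g\<in>H. \<forall>h\<in>H. Y g h = m (\<gamma> + w g) h + m \<gamma> (g \<otimes> h) + m \<gamma> g"
    by (elim exE conjE)
  note m = m'(1)[THEN spec] m'(2)[THEN spec, THEN bspec, THEN bspec]
  have m_shift: "m (0 + u) x = m 0 x + u * (m 0 x + m 1 x)" "m (1 + u) x = m 1 x + u * (m 0 x + m 1 x)"
    for u x by (cases u; simp add: bit_ring)+
  have r_mult: "m 0 (g \<otimes> h) + m 1 (g \<otimes> h) = (m 0 g + m 1 g) + (m 0 h + m 1 h)"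
    if "g \<in> H" "h \<in> H" for g h
  proof -
    have "m (0 + w g) h + m 0 (g \<otimes> h) + m 0 g = m (1 + w g) h + m 1 (g \<otimes> h) + m 1 g"
      using m(2)[OF that, of 0] m(2)[OF that, of 1] by (rule trans[OF sym])
    then have "m 0 (g \<otimes> h) = m 0 h + w g * (m 0 h + m 1 h) + m 0 g +
        (m 1 h + w g * (m 0 h + m 1 h) + m 1 (g \<otimes> h) + m 1 g)"
      unfolding m_shift by (rule bit_cancel)
    then show ?thesis by (simp only: bit_ring)
  qed
  have Y_m: "Y g h + w g * (m 0 h + m 1 h) = m 0 h + m 0 (g \<otimes> h) + m 0 g"
    if "g \<in> H" "h \<in> H" for g h
    unfolding m(2)[OF that, of 0] m_shift by (simp only: bit_ring)
  show ?thesis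
    by (intro exI[of _ "m 0"] exI[of _ "\<lambda>g. m 0 g + m 1 g"] conjI ballI
        locally_const_bit_arith m(1) r_mult Y_m)
next
  case False
  then have w: "w g = 0" if "g \<in> H" for g using that by (cases "w g") auto
  then have "{g \<in> H. w g = 0} = H" by auto
  then show ?thesis
    using \<mu>_lc \<mu> w locally_const_openin[OF w_lc, of "\<lambda>_. True"]
    by (intro exI[of _ \<mu>] exI[of _ "\<lambda>_. 0"]) (auto intro: locally_const_const)
qed

text \<open>Shapiro's lemma in degree 1, with lifting: twisted lifts of the components on the kernel
  of \<open>w\<close> glue to a lift of the coinduced cocycle, whose reduction is
  \<open>\<phi>\<close> itself and not only cohomologous to it.\<close>

lemma shapiro_lift:
  fixes w :: "'a \<Rightarrow> 'v::ab_group_add" and \<phi> :: "'v \<Rightarrow> 'a \<Rightarrow> bit" and \<Theta> :: "'a \<Rightarrow> int" and N :: int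
  assumes w_lc: "locally_const T (carrier G) w"
    and w_hom: "\<And>g h. g \<in> carrier G \<Longrightarrow> h \<in> carrier G \<Longrightarrow> w (g \<otimes> h) = w g + w h"
    and \<Theta>_lc: "locally_const T (carrier G) \<Theta>"
    and \<Theta>_hom: "\<And>g h. g \<in> carrier G \<Longrightarrow> h \<in> carrier G \<Longrightarrow> [\<Theta> (g \<otimes> h) = \<Theta> g * \<Theta> h] (mod N)"
    and \<Theta>_sq: "\<And>g. g \<in> carrier G \<Longrightarrow> [\<Theta> g * \<Theta> g = 1] (mod N)"
    and N: "even N"
    and f_lc: "\<And>v. locally_const T {g \<in> carrier G. w g = 0} (f v)"
    and f_cocycle: "\<And>v g h. g \<in> carrier G \<Longrightarrow> h \<in> carrier G \<Longrightarrow> w g = 0 \<Longrightarrow> w h = 0 \<Longrightarrow>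
      [f v (g \<otimes> h) = f v g + \<Theta> g * f v h] (mod N)"
    and \<phi>: "\<And>v g h. g \<in> carrier G \<Longrightarrow> h \<in> carrier G \<Longrightarrow> \<phi> v (g \<otimes> h) = \<phi> v g + \<phi> (v + w g) h"
    and f_\<phi>: "\<And>v g. g \<in> carrier G \<Longrightarrow> w g = 0 \<Longrightarrow> of_int (f v g) = \<phi> v g"
  shows "\<exists>\<Phi>. (\<forall>v. locally_const T (carrier G) (\<Phi> v)) \<and>
    (\<forall>v. \<forall>g\<in>carrier G. \<forall>h\<in>carrier G. [\<Phi> v (g \<otimes> h) = \<Phi> v g + \<Theta> g * \<Phi> (v + w g) h] (mod N)) \<and>
    (\<forall>v. \<forall>g\<in>carrier G. of_int (\<Phi> v g) = \<phi> v g)"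
proof -
  have w_one: "w \<one> = 0" using w_hom[of \<one> \<one>] by simp
  have w_inv: "w (inv g) = - w g" if "g \<in> carrier G" for g
  proof -
    have "w g + w (inv g) = 0" using w_hom[of g "inv g"] that w_one by simp
    then show ?thesis by (rule minus_unique[symmetric])
  qed
  \<comment> \<open>Since \<open>w\<close> may miss values, the indices split into cosets of its
    image. One index \<open>rep v\<close> is chosen in each coset, with a group element
    \<open>base v\<close> that moves it to \<open>v\<close>.\<close>
  define orbit where "orbit v = {u. \<exists>x\<in>carrier G. u + w x = v}" for v
  define rep where "rep v = (SOME u. u \<in> orbit v)" for v
  define base where "base v = (SOME x. x \<in> carrier G \<and> rep v + w x = v)" for v
  have "v \<in> orbit v" for v unfolding orbit_def using w_one by force
  then have "rep v \<in> orbit v" for v unfolding rep_def by (metis someI)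
  then have base: "base v \<in> carrier G" "rep v + w (base v) = v" for v
    using someI_ex[of "\<lambda>x. x \<in> carrier G \<and> rep v + w x = v"] by (auto simp: base_def orbit_def)
  have sub: "orbit (v + w g) \<subseteq> orbit v" if g: "g \<in> carrier G" for v g
  proof
    fix u
    assume "u \<in> orbit (v + w g)"
    then obtain x where x: "x \<in> carrier G" "u + w x = v + w g" by (auto simp: orbit_def)
    have "u + w (x \<otimes> inv g) = (u + w x) - w g" using x(1) g by (simp add: w_hom w_inv)
    also have "\<dots> = v" unfolding x(2) by simp
    finally have "u + w (x \<otimes> inv g) = v" .
    then show "u \<in> orbit v" unfolding orbit_def using x g by blast
  qed
  have "orbit (v + w g) = orbit v" if g: "g \<in> carrier G" for v g
    using sub[OF g, of v] sub[OF inv_closed[OF g], of "v + w g"] g by (simp add: w_inv)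
  then have rep: "rep (v + w g) = rep v" if "g \<in> carrier G" for v g
    using that unfolding rep_def by simp
  \<comment> \<open>The formula for \<open>\<Phi>\<close> comes from expanding a cocycle of index
    \<open>rep v\<close> at
    \<open>base v \<otimes> g = \<kappa> v g \<otimes> base (v + w g)\<close> in two ways, with
    \<open>n v\<close> in the role of its value at \<open>base v\<close>. As \<open>n v\<close>
    lifts the value of \<open>\<phi>\<close> there, the reduction is exact;
    \<open>\<Theta> (base v)\<close> is its own inverse modulo \<open>N\<close>.\<close>
  define n where "n v = int_of_bit (\<phi> (rep v) (base v))" for v
  define \<kappa> where "\<kappa> v g = base v \<otimes> g \<otimes> inv (base (v + w g))" for v g
  define \<Phi> where "\<Phi> v g = \<Theta> (base v) * (f (rep v) (\<kappa> v g) + \<Theta> (\<kappa> v g) * n (v + w g) - n v)" for v g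
  have \<kappa>: "\<kappa> v g \<in> carrier G" "w (\<kappa> v g) = 0" "\<kappa> v g \<otimes> base (v + w g) = base v \<otimes> g"
    if g: "g \<in> carrier G" for v g
  proof -
    show "\<kappa> v g \<in> carrier G" "\<kappa> v g \<otimes> base (v + w g) = base v \<otimes> g"
      using g base(1) by (simp_all add: \<kappa>_def m_assoc)
    have "w (base v) = v - rep v" "w (base (v + w g)) = v + w g - rep v"
      using base(2)[of v] base(2)[of "v + w g"] unfolding rep[OF g, of v] by (metis add_diff_cancel_left')+
    then show "w (\<kappa> v g) = 0" using g base(1) by (simp add: \<kappa>_def w_hom w_inv)
  qed
  have \<kappa>_mult: "\<kappa> v (g \<otimes> h) = \<kappa> v g \<otimes> \<kappa> (v + w g) h" if "g \<in> carrier G" "h \<in> carrier G" for v g h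
  proof -
    have "\<kappa> v g \<otimes> \<kappa> (v + w g) h = (\<kappa> v g \<otimes> base (v + w g)) \<otimes> (h \<otimes> inv (base (v + w g + w h)))"
      unfolding \<kappa>_def[of "v + w g" h] using that base(1) \<kappa>(1) by (simp add: m_assoc)
    also have "\<dots> = (base v \<otimes> g) \<otimes> (h \<otimes> inv (base (v + w g + w h)))"
      by (simp only: \<kappa>(3)[OF that(1)])
    also have "\<dots> = \<kappa> v (g \<otimes> h)"
      unfolding \<kappa>_def[of v "g \<otimes> h"] using that base(1) by (simp add: w_hom m_assoc add.assoc)
    finally show ?thesis ..
  qed
  have \<Phi>_cocycle: "[\<Phi> v (g \<otimes> h) = \<Phi> v g + \<Theta> g * \<Phi> (v + w g) h] (mod N)"
    if g: "g \<in> carrier G" and h: "h \<in> carrier G" for v g h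
  proof -
    define k k' where "k = \<kappa> v g" and "k' = \<kappa> (v + w g) h"
    define x y where "x = base v" and "y = base (v + w g)"
    define c d e where "c = n v" and "d = n (v + w g)" and "e = n (v + w g + w h)"
    have kk': "k \<in> carrier G" "k' \<in> carrier G" "w k = 0" "w k' = 0" "x \<in> carrier G" "y \<in> carrier G"
      using \<kappa> g h base by (auto simp: k_def k'_def x_def y_def)
    have ky: "k \<otimes> y = x \<otimes> g" using \<kappa>(3)[OF g] by (simp add: k_def y_def x_def)
    have "[\<Theta> k * \<Theta> y = \<Theta> x * \<Theta> g] (mod N)"
      using cong_trans[OF cong_sym[OF \<Theta>_hom[of k y]] \<Theta>_hom[of x g, folded ky]] kk' g by blast
    then have "[\<Theta> k * \<Theta> y * (\<Theta> x * \<Theta> y) = \<Theta> x * \<Theta> g * (\<Theta> x * \<Theta> y)] (mod N)"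
      by (rule cong_mult) simp
    then have "[(\<Theta> y * \<Theta> y) * (\<Theta> x * \<Theta> k) = (\<Theta> x * \<Theta> x) * (\<Theta> g * \<Theta> y)] (mod N)"
      by (simp add: mult_ac)
    from cong_trans[OF cong_trans[OF cong_sym[OF cong_mult[OF \<Theta>_sq[OF kk'(6)] cong_refl]] this]
        cong_mult[OF \<Theta>_sq[OF kk'(5)] cong_refl]]
    have swap: "[\<Theta> x * \<Theta> k = \<Theta> g * \<Theta> y] (mod N)" unfolding mult_1 .
    have "\<Phi> v (g \<otimes> h) = \<Theta> x * (f (rep v) (k \<otimes> k') + \<Theta> (k \<otimes> k') * e - c)"
      using g h by (simp add: \<Phi>_def \<kappa>_mult w_hom k_def k'_def x_def e_def c_def add.assoc)
    also have "[\<dots> = \<Theta> x * (f (rep v) k + \<Theta> k * f (rep v) k' + \<Theta> k * \<Theta> k' * e - c)] (mod N)"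
      by (intro cong_mult[OF cong_refl] cong_diff[OF _ cong_refl] cong_add
          f_cocycle cong_mult[OF _ cong_refl] \<Theta>_hom kk')
    also have "\<Theta> x * (f (rep v) k + \<Theta> k * f (rep v) k' + \<Theta> k * \<Theta> k' * e - c) =
        \<Theta> x * (f (rep v) k + \<Theta> k * d - c) + \<Theta> x * \<Theta> k * (f (rep v) k' + \<Theta> k' * e - d)"
      by (simp add: algebra_simps)
    also have "[\<dots> = \<Theta> x * (f (rep v) k + \<Theta> k * d - c) +
        \<Theta> g * \<Theta> y * (f (rep v) k' + \<Theta> k' * e - d)] (mod N)"
      by (intro cong_add cong_refl cong_mult[OF swap])
    also have "\<Theta> x * (f (rep v) k + \<Theta> k * d - c) = \<Phi> v g"
      by (simp add: \<Phi>_def k_def x_def c_def d_def)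
    also have "\<Theta> g * \<Theta> y * (f (rep v) k' + \<Theta> k' * e - d) = \<Theta> g * \<Phi> (v + w g) h"
      using g by (simp add: \<Phi>_def k'_def y_def e_def d_def rep)
    finally show ?thesis .
  qed
  have \<Phi>_bit: "of_int (\<Phi> v g) = \<phi> v g" if g: "g \<in> carrier G" for v g
  proof -
    have \<Theta>_bit: "(of_int (\<Theta> x) :: bit) = 1" if "x \<in> carrier G" for x
    proof -
      have "[\<Theta> x * \<Theta> x = 1] (mod 2)"
        using cong_dvd_modulus[OF \<Theta>_sq[OF that]] N by blast
      then have "odd (\<Theta> x * \<Theta> x)" unfolding odd_iff_mod_2_eq_one cong_def by simp
      then have "odd (\<Theta> x)" by simp
      then show ?thesis by (simp add: of_int_bit_eq)
    qed
    have "of_int (\<Phi> v g) = \<phi> (rep v) (\<kappa> v g) + \<phi> (rep v) (base (v + w g)) + \<phi> (rep v) (base v)"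
      using g \<kappa>(1,2)[OF g, of v] base(1)
      by (simp add: \<Phi>_def \<Theta>_bit f_\<phi> n_def rep bit_minus)
    also have "\<phi> (rep v) (\<kappa> v g) + \<phi> (rep v) (base (v + w g)) = \<phi> (rep v) (base v \<otimes> g)"
      using \<phi>[of "\<kappa> v g" "base (v + w g)" "rep v"] \<kappa>[OF g, of v] base(1) by simp
    also have "\<dots> = \<phi> (rep v) (base v) + \<phi> v g"
      using \<phi>[of "base v" g "rep v"] g base(1)[of v] base(2)[of v] by simp
    finally show ?thesis by (simp only: bit_ring)
  qed
  have \<Phi>_lc: "locally_const T (carrier G) (\<Phi> v)" for v
  proof (rule locally_const_pieces[where w = w])
    fix u
    define x y where "x = base v" and "y = inv (base (v + u))"
    let ?K = "{g \<in> carrier G. w g = 0}"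
    have xy: "x \<in> carrier G" "y \<in> carrier G" using base by (auto simp: x_def y_def)
    have "locally_const T ?K (\<lambda>k. \<Theta> x * (f (rep v) k + \<Theta> k * n (v + u) - n v))"
      using f_lc[of "rep v"] locally_const_subset[OF \<Theta>_lc, of ?K] w_lc
      by (intro locally_const_comp2[where F = "\<lambda>a b. \<Theta> x * (a + b * n (v + u) - n v)"])
        (auto simp: locally_const_def)
    from locally_const_left[OF locally_const_right[OF this xy(2)] xy(1)]
    have "locally_const T {g \<in> carrier G. x \<otimes> g \<in> {g \<in> carrier G. g \<otimes> y \<in> ?K}}
      (\<lambda>g. \<Theta> x * (f (rep v) (x \<otimes> g \<otimes> y) + \<Theta> (x \<otimes> g \<otimes> y) * n (v + u) - n v))" .
    moreover have "openin T {h \<in> carrier G. w h = u}" using w_lc by (simp add: locally_const_def)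
    moreover have "x \<otimes> g \<otimes> y = \<kappa> v g" if "w g = u" for g using that by (simp add: \<kappa>_def x_def y_def)
    then have "{h \<in> carrier G. w h = u} \<subseteq>
        {g \<in> carrier G. x \<otimes> g \<in> {g \<in> carrier G. g \<otimes> y \<in> ?K}}"
      using xy \<kappa>(1,2) by auto
    ultimately have "locally_const T {h \<in> carrier G. w h = u}
      (\<lambda>g. \<Theta> x * (f (rep v) (x \<otimes> g \<otimes> y) + \<Theta> (x \<otimes> g \<otimes> y) * n (v + u) - n v))"
      by (rule locally_const_subset)
    then show "locally_const T {h \<in> carrier G. w h = u} (\<Phi> v)"
      by (rule locally_const_cong) (auto simp: \<Phi>_def \<kappa>_def x_def y_def)
  qed
  show ?thesis
  proof (intro exI[of _ \<Phi>] conjI allI ballI)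
    show "locally_const T (carrier G) (\<Phi> v)" for v by (rule \<Phi>_lc)
    show "[\<Phi> v (g \<otimes> h) = \<Phi> v g + \<Theta> g * \<Phi> (v + w g) h] (mod N)"
      if "g \<in> carrier G" "h \<in> carrier G" for v g h using that by (rule \<Phi>_cocycle)
    show "of_int (\<Phi> v g) = \<phi> v g" if "g \<in> carrier G" for v g using that by (rule \<Phi>_bit)
  qed
qed

end

section \<open>Lifts to twisted coefficients\<close>

text \<open>\<open>\<Theta>\<close> is the orientation modulo 16, one binary digit more than the
  coefficients Z/8(1), because halving \<open>\<Theta> g - 1\<close> loses a digit. The assumption
  \<open>lift\<close> is formal Hilbert 90 for Z/8(1).\<close>

locale kummer_group = top_group +
  fixes \<Theta> :: "'a \<Rightarrow> int"
  assumes \<Theta>_lc: "locally_const T (carrier G) \<Theta>"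
    and \<Theta>_odd: "g \<in> carrier G \<Longrightarrow> odd (\<Theta> g)"
    and \<Theta>_mult: "g \<in> carrier G \<Longrightarrow> h \<in> carrier G \<Longrightarrow> [\<Theta> (g \<otimes> h) = \<Theta> g * \<Theta> h] (mod 16)"
    and lift: "subgroup H G \<Longrightarrow> openin T H \<Longrightarrow> locally_const T H f \<Longrightarrow>
      (\<And>g h. g \<in> H \<Longrightarrow> h \<in> H \<Longrightarrow> f (g \<otimes> h) = f g + f h) \<Longrightarrow>
      \<exists>c. locally_const T H c \<and> (\<forall>g\<in>H. of_int (c g) = (f g :: bit)) \<and>
        (\<forall>g\<in>H. \<forall>h\<in>H. [c (g \<otimes> h) = c g + \<Theta> g * c h] (mod 8))"
begin

text \<open>The Kummer cocycle of -1 in Z/8(1): for a cyclotomic orientation, \<open>g\<close>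
  multiplies an eighth root of -1 by the power \<open>\<tau> g\<close> of its square.\<close>

definition \<tau> :: "'a \<Rightarrow> int" where "\<tau> g = (\<Theta> g - 1) div 2"

definition \<epsilon> :: "'a \<Rightarrow> bit" where "\<epsilon> g = hi (\<Theta> g)"

text \<open>On the group this is trivial exactly where \<open>\<Theta> g\<close> is 1 or 3 modulo 8,
  so for a cyclotomic orientation it is the character of -2.\<close>

definition \<epsilon>' :: "'a \<Rightarrow> bit" where "\<epsilon>' g = hi (\<tau> g)"

lemma \<Theta>_\<tau>: "g \<in> carrier G \<Longrightarrow> \<Theta> g = 1 + 2 * \<tau> g"
  using \<Theta>_odd[of g] by (simp add: \<tau>_def)

lemma of_int_\<Theta>: "g \<in> carrier G \<Longrightarrow> (of_int (\<Theta> g) :: bit) = 1"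
  using \<Theta>_odd[of g] by (simp add: of_int_bit_eq)

lemma of_int_\<tau>: "g \<in> carrier G \<Longrightarrow> of_int (\<tau> g) = \<epsilon> g"
  by (simp add: \<epsilon>_def hi_def \<Theta>_\<tau>)

lemma \<Theta>_sq: "g \<in> carrier G \<Longrightarrow> [\<Theta> g * \<Theta> g = 1] (mod 8)"
proof -
  have "[x * x = 1] (mod 8)" if "odd x" for x :: int
  proof -
    have "x mod 8 = 1 \<or> x mod 8 = 3 \<or> x mod 8 = 5 \<or> x mod 8 = 7" using that by presburger
    then have "((x mod 8) * (x mod 8)) mod 8 = 1" by auto
    then show ?thesis by (simp add: cong_def mod_mult_eq)
  qed
  then show "g \<in> carrier G \<Longrightarrow> [\<Theta> g * \<Theta> g = 1] (mod 8)" using \<Theta>_odd by blast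
qed

lemma \<Theta>_mult8: "g \<in> carrier G \<Longrightarrow> h \<in> carrier G \<Longrightarrow> [\<Theta> (g \<otimes> h) = \<Theta> g * \<Theta> h] (mod 8)"
  using cong_dvd_modulus[OF \<Theta>_mult, of g h 8] by simp

lemma \<tau>_mult:
  assumes "g \<in> carrier G" "h \<in> carrier G"
  shows "[\<tau> (g \<otimes> h) = \<tau> g + \<Theta> g * \<tau> h] (mod 8)"
proof -
  obtain k where "\<Theta> g * \<Theta> h = \<Theta> (g \<otimes> h) + 16 * k"
    using \<Theta>_mult[OF assms] unfolding cong_iff_lin by blast
  then have "\<tau> g + \<Theta> g * \<tau> h = \<tau> (g \<otimes> h) + 8 * k"
    using assms by (simp add: \<Theta>_\<tau> algebra_simps)
  then show ?thesis unfolding cong_iff_lin by blast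
qed

lemma \<epsilon>_mult: "g \<in> carrier G \<Longrightarrow> h \<in> carrier G \<Longrightarrow> \<epsilon> (g \<otimes> h) = \<epsilon> g + \<epsilon> h"
  using hi_cong[OF cong_dvd_modulus[OF \<Theta>_mult, of g h 4]]
  by (simp add: \<epsilon>_def hi_mult of_int_\<Theta> add.commute)

text \<open>The carry \<open>\<epsilon> g * \<epsilon> h\<close> of the sum
  \<open>\<tau> g + \<Theta> g * \<tau> h\<close> cancels against the upper digit of
  \<open>\<Theta> g\<close> times \<open>\<tau> h\<close>.\<close>

lemma \<epsilon>'_mult: "g \<in> carrier G \<Longrightarrow> h \<in> carrier G \<Longrightarrow> \<epsilon>' (g \<otimes> h) = \<epsilon>' g + \<epsilon>' h"
  using hi_cong[OF cong_dvd_modulus[OF \<tau>_mult, of g h 4]]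
  by (simp add: \<epsilon>'_def hi_add hi_mult of_int_\<Theta> of_int_\<tau> flip: \<epsilon>_def)

lemma \<tau>_lc: "locally_const T (carrier G) \<tau>"
  unfolding \<tau>_def by (rule locally_const_comp[OF \<Theta>_lc])

lemma \<epsilon>_lc: "locally_const T (carrier G) \<epsilon>"
  unfolding \<epsilon>_def by (rule locally_const_comp[OF \<Theta>_lc])

lemma \<epsilon>'_lc: "locally_const T (carrier G) \<epsilon>'"
  unfolding \<epsilon>'_def by (rule locally_const_comp[OF \<tau>_lc])

section \<open>The Bockstein relation for twisted coefficients\<close>

lemma hi_cocycle:
  assumes "[x = y + \<theta> * z] (mod 4)" "odd \<theta>"
  shows "hi x = hi y + hi z + hi \<theta> * of_int z + of_int y * of_int z"
proof -
  have "(of_int \<theta> :: bit) = 1" using assms(2) by (simp add: of_int_bit_eq)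
  then show ?thesis using hi_cong[OF assms(1)] by (simp only: hi_add hi_mult of_int_mult bit_ring)
qed

text \<open>The left side is the obstruction to lifting \<open>f\<close> to Z/4(1), which vanishes
  by \<open>lift\<close>; the upper digit of a lift is a primitive. In symbols of Kummer theory this
  is (f, -f) = 0.\<close>

lemma bockstein:
  assumes "subgroup H G" "openin T H" "locally_const T H f"
    and "\<And>g h. g \<in> H \<Longrightarrow> h \<in> H \<Longrightarrow> f (g \<otimes> h) = f g + f h"
  shows "\<exists>\<rho>. locally_const T H \<rho> \<and>
    (\<forall>g\<in>H. \<forall>h\<in>H. f g * f h + \<epsilon> g * f h = \<rho> h + \<rho> (g \<otimes> h) + \<rho> g)"
proof -
  interpret H: subgroup H G by fact
  obtain c where c: "locally_const T H c" "\<And>g. g \<in> H \<Longrightarrow> of_int (c g) = f g"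
    "\<And>g h. g \<in> H \<Longrightarrow> h \<in> H \<Longrightarrow> [c (g \<otimes> h) = c g + \<Theta> g * c h] (mod 8)"
    using lift[OF assms] by blast
  have "f g * f h + \<epsilon> g * f h = hi (c h) + hi (c (g \<otimes> h)) + hi (c g)" if "g \<in> H" "h \<in> H" for g h
  proof -
    have "[c (g \<otimes> h) = c g + \<Theta> g * c h] (mod 4)" using cong_dvd_modulus[OF c(3)[OF that]] by simp
    from hi_cocycle[OF this \<Theta>_odd] that show ?thesis
      by (simp only: c(2) H.mem_carrier bit_ring flip: \<epsilon>_def)
  qed
  then show ?thesis using locally_const_comp[OF c(1), of hi] by (intro exI[of _ "\<lambda>g. hi (c g)"]) simp
qed

end

locale massey_family = kummer_group +
  fixes b c :: "'a \<Rightarrow> bit" and \<Phi> :: "bit \<Rightarrow> bit \<Rightarrow> 'a \<Rightarrow> int"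
  assumes b_lc: "locally_const T (carrier G) b" and c_lc: "locally_const T (carrier G) c"
    and b_mult: "g \<in> carrier G \<Longrightarrow> h \<in> carrier G \<Longrightarrow> b (g \<otimes> h) = b g + b h"
    and c_mult: "g \<in> carrier G \<Longrightarrow> h \<in> carrier G \<Longrightarrow> c (g \<otimes> h) = c g + c h"
    and \<Phi>_lc: "locally_const T (carrier G) (\<Phi> \<beta> \<gamma>)"
    and \<Phi>_mult: "g \<in> carrier G \<Longrightarrow> h \<in> carrier G \<Longrightarrow>
      [\<Phi> \<beta> \<gamma> (g \<otimes> h) = \<Phi> \<beta> \<gamma> g + \<Theta> g * \<Phi> (\<beta> + b g) (\<gamma> + c g) h] (mod 8)"
begin

text \<open>\<open>\<Phi>\<close> encodes a cocycle with values in the module coinduced from the common kernel of b and c,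
  its components being indexed by the values of (b, c). The cochain \<open>Z\<close> is the class of a square root
  of -Q; the summands \<open>\<epsilon>'\<close> and \<open>\<epsilon>\<close> account for the root of -1.\<close>

definition I :: "bit \<Rightarrow> 'a \<Rightarrow> bit" where "I \<gamma> g = of_int (\<Phi> 0 \<gamma> g)"

definition Q :: "bit \<Rightarrow> 'a \<Rightarrow> int" where "Q \<gamma> g = \<Phi> 0 \<gamma> g + \<Phi> 1 \<gamma> g"

definition q :: "bit \<Rightarrow> 'a \<Rightarrow> bit" where "q \<gamma> g = of_int (Q \<gamma> g)"

definition Z :: "bit \<Rightarrow> 'a \<Rightarrow> bit" where
  "Z \<gamma> g = hi (Q \<gamma> g) + \<epsilon>' g + \<epsilon> g + q \<gamma> g + q \<gamma> g * \<epsilon> g"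

text \<open>A value of the triple Massey product of \<open>b\<close>, \<open>q\<close> and
  \<open>q + \<epsilon>\<close> for the primitives \<open>I\<close> and \<open>Z\<close>; in Kummer
  terms b sqrt(-q) + i (q + e).\<close>

definition Y :: "bit \<Rightarrow> 'a \<Rightarrow> 'a \<Rightarrow> bit" where
  "Y \<gamma> g h = b g * Z (\<gamma> + c g) h + I \<gamma> g * (q (\<gamma> + c g) h + \<epsilon> h)"

section \<open>Coboundaries of the cochains attached to \<Phi>\<close>

lemma Q_mult:
  assumes "g \<in> carrier G" "h \<in> carrier G"
  shows "[Q \<gamma> (g \<otimes> h) = Q \<gamma> g + \<Theta> g * Q (\<gamma> + c g) h] (mod 8)"
proof -
  have "[Q \<gamma> (g \<otimes> h) = (\<Phi> 0 \<gamma> g + \<Theta> g * \<Phi> (0 + b g) (\<gamma> + c g) h) +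
      (\<Phi> 1 \<gamma> g + \<Theta> g * \<Phi> (1 + b g) (\<gamma> + c g) h)] (mod 8)" (is "[_ = ?rhs] (mod 8)")
    unfolding Q_def by (intro cong_add \<Phi>_mult assms)
  also have "?rhs = Q \<gamma> g + \<Theta> g * Q (\<gamma> + c g) h"
    by (cases "b g") (simp_all add: Q_def algebra_simps)
  finally show ?thesis .
qed

text \<open>If \<open>b g = 1\<close>, the action of \<open>g\<close> passes from component 0 to
  component 1, which modulo 2 adds the corestriction \<open>q\<close>. So \<open>I\<close> is a
  primitive of the cup product of \<open>b\<close> and \<open>q\<close>.\<close>

lemma I_mult:
  assumes "g \<in> carrier G" "h \<in> carrier G"
  shows "I \<gamma> (g \<otimes> h) = I \<gamma> g + I (\<gamma> + c g) h + b g * q (\<gamma> + c g) h"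
proof -
  have "[\<Phi> 0 \<gamma> (g \<otimes> h) = \<Phi> 0 \<gamma> g + \<Theta> g * \<Phi> (0 + b g) (\<gamma> + c g) h] (mod 2)"
    by (rule cong_dvd_modulus[OF \<Phi>_mult[OF assms]]) simp
  from of_int_bit_cong[OF this]
  have "I \<gamma> (g \<otimes> h) = I \<gamma> g + of_int (\<Phi> (b g) (\<gamma> + c g) h)"
    using assms by (simp add: I_def of_int_\<Theta>)
  also have "of_int (\<Phi> (b g) (\<gamma> + c g) h) = I (\<gamma> + c g) h + b g * q (\<gamma> + c g) h"
    by (cases "b g") (simp_all add: I_def q_def Q_def bit_add_left_self)
  finally show ?thesis by (simp only: add_ac)
qed

lemma q_mult:
  assumes "g \<in> carrier G" "h \<in> carrier G"
  shows "q \<gamma> (g \<otimes> h) = q \<gamma> g + q (\<gamma> + c g) h"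
  using of_int_bit_cong[OF cong_dvd_modulus[OF Q_mult[OF assms, of \<gamma>], of 2]] assms
  by (simp add: q_def of_int_\<Theta>)

lemma hi_Q_mult:
  assumes "g \<in> carrier G" "h \<in> carrier G"
  shows "hi (Q \<gamma> (g \<otimes> h)) = hi (Q \<gamma> g) + hi (Q (\<gamma> + c g) h) + \<epsilon> g * q (\<gamma> + c g) h
    + q \<gamma> g * q (\<gamma> + c g) h"
proof -
  have "[Q \<gamma> (g \<otimes> h) = Q \<gamma> g + \<Theta> g * Q (\<gamma> + c g) h] (mod 4)"
    by (rule cong_dvd_modulus[OF Q_mult[OF assms]]) simp
  from hi_cocycle[OF this \<Theta>_odd[OF assms(1)]] show ?thesis by (simp only: \<epsilon>_def q_def)
qed

text \<open>The upper digit of \<open>Q\<close> contributes the cup products of \<open>q\<close>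
  with \<open>q\<close> and of \<open>\<epsilon>\<close> with \<open>q\<close>; the summand
  \<open>q \<gamma> g * \<epsilon> g\<close> reverses the order in the latter. The remaining
  summands are cocycles.\<close>

lemma Z_mult:
  assumes "g \<in> carrier G" "h \<in> carrier G"
  shows "Z \<gamma> (g \<otimes> h) = Z \<gamma> g + Z (\<gamma> + c g) h + q \<gamma> g * (q (\<gamma> + c g) h + \<epsilon> h)"
  by (simp only: Z_def hi_Q_mult[OF assms] \<epsilon>'_mult[OF assms] \<epsilon>_mult[OF assms] q_mult[OF assms] bit_ring)

text \<open>Each of the two summands of \<open>Y\<close> has the triple cup product of
  \<open>b\<close>, \<open>q\<close> and \<open>q + \<epsilon>\<close> as its coboundary.\<close>

lemma Y_cocycle:
  assumes "g \<in> carrier G" "h \<in> carrier G" "k \<in> carrier G"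
  shows "Y (\<gamma> + c g) h k + Y \<gamma> (g \<otimes> h) k + Y \<gamma> g (h \<otimes> k) + Y \<gamma> g h = 0"
proof -
  have c: "\<gamma> + c (g \<otimes> h) = \<gamma> + c g + c h" using assms by (simp add: c_mult add.assoc)
  show ?thesis using assms
    by (simp only: Y_def c Z_mult I_mult q_mult \<epsilon>_mult b_mult bit_ring)
qed

lemma Q_lc: "locally_const T (carrier G) (Q \<gamma>)"
  unfolding Q_def by (rule locally_const_comp2[OF \<Phi>_lc \<Phi>_lc])

lemma I_lc: "locally_const T (carrier G) (I \<gamma>)"
  unfolding I_def by (rule locally_const_comp[OF \<Phi>_lc])

lemma q_lc: "locally_const T (carrier G) (q \<gamma>)"
  unfolding q_def by (rule locally_const_comp[OF Q_lc])

lemma Z_lc: "locally_const T (carrier G) (Z \<gamma>)"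
  unfolding Z_def
  by (intro locally_const_bit_arith q_lc \<epsilon>_lc \<epsilon>'_lc locally_const_comp[OF Q_lc])

lemma Y_lc: "locally_const T (carrier G) (\<lambda>g. Y \<gamma> g x)" "locally_const T (carrier G) (\<lambda>g. Y \<gamma> x g)"
proof -
  have "locally_const T (carrier G) (\<lambda>g. b g * Z' (c g) + I \<gamma> g * (q' (c g) + e))" for Z' q' and e :: bit
    by (intro locally_const_bit_arith b_lc I_lc locally_const_comp[OF c_lc]
        locally_const_const[OF openin_carrier])
  from this[of "\<lambda>u. Z (\<gamma> + u) x" "\<lambda>u. q (\<gamma> + u) x" "\<epsilon> x"]
  show "locally_const T (carrier G) (\<lambda>g. Y \<gamma> g x)" by (simp add: Y_def)
  show "locally_const T (carrier G) (\<lambda>g. Y \<gamma> x g)"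
    unfolding Y_def
    by (intro locally_const_bit_arith Z_lc q_lc \<epsilon>_lc locally_const_const[OF openin_carrier])
qed


section \<open>Vanishing on L and descent to K\<close>

abbreviation "K \<equiv> {g \<in> carrier G. c g = 0}"

abbreviation "w g \<equiv> b g + q 0 g + \<epsilon> g"

abbreviation "L \<equiv> {g \<in> K. w g = 0}"

lemma K_subgroup: "subgroup K G"
  using c_mult by (intro kernel_subgroup subgroup_self)

lemma K_open: "openin T K"
  using c_lc by (simp add: locally_const_def)

lemma w_mult: "g \<in> K \<Longrightarrow> h \<in> K \<Longrightarrow> w (g \<otimes> h) = w g + w h"
  by (simp add: b_mult q_mult \<epsilon>_mult add_ac)

lemma w_lc: "locally_const T K w"
proof (rule locally_const_subset[OF _ K_open])
  show "locally_const T (carrier G) w"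
    by (intro locally_const_bit_arith b_lc q_lc \<epsilon>_lc)
qed simp

lemma L_subgroup: "subgroup L G"
  by (rule kernel_subgroup[OF K_subgroup w_mult])

lemma L_open: "openin T L"
  using w_lc by (simp add: locally_const_def)

text \<open>The difference \<open>\<Phi> 0 0 g - \<Phi> 1 0 g\<close> minus half of
  \<open>\<Theta> g * sign g - 1\<close>. The former stands for i divided by its conjugate, the
  latter is the analogue of \<open>\<tau>\<close> for the orientation twisted by \<open>b\<close>.
  In Kummer terms \<open>U\<close> is the square of i / sqrt(-q).\<close>

definition U :: "'a \<Rightarrow> int" where
  "U g = 2 * \<Phi> 0 0 g - Q 0 g - \<tau> g + int_of_bit (b g) * \<Theta> g"

definition sign :: "'a \<Rightarrow> int" where
  "sign g = 1 - 2 * int_of_bit (b g)"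

text \<open>An element with \<open>b g = 1\<close> exchanges the two components of
  \<open>\<Phi>\<close> and negates their difference; this is the source of the twist by
  \<open>sign\<close>.\<close>

lemma U_mult:
  assumes g: "g \<in> K" and h: "h \<in> K"
  shows "[U (g \<otimes> h) = U g + \<Theta> g * sign g * U h] (mod 8)"
proof -
  have gh: "g \<in> carrier G" "h \<in> carrier G" "c g = 0" using g h by auto
  have \<Phi>: "[\<Phi> 0 0 (g \<otimes> h) = \<Phi> 0 0 g + \<Theta> g * \<Phi> (b g) 0 h] (mod 8)"
    using \<Phi>_mult[OF gh(1,2), of 0 0] gh(3) by simp
  have Q: "[Q 0 (g \<otimes> h) = Q 0 g + \<Theta> g * Q 0 h] (mod 8)"
    using Q_mult[OF gh(1,2), of 0] gh(3) by simp
  have "[U (g \<otimes> h) = 2 * (\<Phi> 0 0 g + \<Theta> g * \<Phi> (b g) 0 h) - (Q 0 g + \<Theta> g * Q 0 h)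
      - (\<tau> g + \<Theta> g * \<tau> h) + int_of_bit (b g + b h) * (\<Theta> g * \<Theta> h)] (mod 8)"
    (is "[_ = ?rhs] (mod 8)")
    unfolding U_def b_mult[OF gh(1,2)]
    by (intro cong_add cong_diff cong_scalar_left \<Phi> Q \<tau>_mult \<Theta>_mult8 gh)
  also have "?rhs = U g + \<Theta> g * sign g * U h"
  proof (cases "b g")
    case zero
    then show ?thesis by (simp add: U_def sign_def int_of_bit_def algebra_simps)
  next
    case one
    then show ?thesis
      by (cases "b h") (simp_all add: U_def sign_def int_of_bit_def Q_def \<Theta>_\<tau>[OF gh(2)] algebra_simps)
  qed
  finally show ?thesis .
qed

lemma U_even: "g \<in> L \<Longrightarrow> even (U g)"
proof -
  assume g: "g \<in> L"
  then have "(of_int (U g) :: bit) = q 0 g + \<epsilon> g + b g"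
    by (simp add: U_def q_def of_int_\<tau> of_int_\<Theta> bit_minus)
  also have "\<dots> = w g" by (simp only: add_ac)
  also have "\<dots> = 0" using g by simp
  finally show "even (U g)" by (simp add: of_int_bit_eq split: if_splits)
qed

text \<open>Half of \<open>U\<close> represents i / sqrt(-q). On \<open>L\<close>, where
  \<open>q 0 g + \<epsilon> g = b g\<close>, the right side is
  \<open>I 0 g + Z 0 g + q 0 g * b g\<close>.\<close>

lemma hi_U:
  assumes g: "g \<in> L"
  shows "hi (U g) = I 0 g + hi (Q 0 g) + \<epsilon>' g + \<epsilon> g"
proof -
  have carrier: "g \<in> carrier G" using g by simp
  have "w g = 0" using g by simp
  then have b: "b g = q 0 g + \<epsilon> g" by (cases "b g"; cases "q 0 g"; cases "\<epsilon> g") auto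
  have "hi (int_of_bit (b g)) = 0" "hi 2 = 1" by (simp_all add: int_of_bit_def hi_def)
  then show ?thesis using carrier
    by (simp add: U_def diff_conv_add_uminus hi_add hi_mult hi_uminus of_int_\<tau> of_int_\<Theta>
          I_def[symmetric] q_def[symmetric] \<epsilon>_def[symmetric] \<epsilon>'_def[symmetric] del: add_uminus_conv_diff)
      (simp only: b bit_ring)
qed

lemma hi_sign: "hi (sign g) = b g"
  by (cases "b g") (simp_all add: sign_def int_of_bit_def hi_def)

lemma odd_sign: "odd (sign g)"
  by (simp add: sign_def)

lemma hi_\<Theta>_sign: "g \<in> carrier G \<Longrightarrow> hi (\<Theta> g * sign g) = \<epsilon> g + b g"
proof -
  have "(of_int (sign g) :: bit) = 1" using odd_sign[of g] by (simp add: of_int_bit_eq)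
  then show "g \<in> carrier G \<Longrightarrow> hi (\<Theta> g * sign g) = \<epsilon> g + b g"
    by (simp add: hi_mult hi_sign of_int_\<Theta> \<epsilon>_def)
qed

text \<open>The class r of the quotient i / sqrt(-q), which has norm 1 on L, lifts to Z/4 twisted by
  \<open>\<Theta>\<close> and b (by the construction of U) and to Z/4 twisted by \<open>\<Theta>\<close> alone (by formal Hilbert 90). The
  Bockstein classes of the two lifts differ by the cup product of b and r.\<close>

lemma cup_b_vanishes:
  "\<exists>\<kappa>. locally_const T L \<kappa> \<and> (\<forall>g\<in>L. \<forall>h\<in>L.
     b g * (I 0 h + hi (Q 0 h) + \<epsilon>' h + \<epsilon> h) = \<kappa> h + \<kappa> (g \<otimes> h) + \<kappa> g)"
proof -
  interpret L: subgroup L G by (rule L_subgroup)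
  define R where "R g = U g div 2" for g
  define r :: "'a \<Rightarrow> bit" where "r g = of_int (R g)" for g
  have r: "r g = I 0 g + hi (Q 0 g) + \<epsilon>' g + \<epsilon> g" if "g \<in> L" for g
    using hi_U[OF that] by (simp add: r_def R_def hi_def)
  have R_mult: "[R (g \<otimes> h) = R g + \<Theta> g * sign g * R h] (mod 4)" if gh: "g \<in> L" "h \<in> L" for g h
  proof -
    have UR: "U k = 2 * R k" if "k \<in> L" for k using U_even[OF that] by (simp add: R_def)
    obtain k where "U g + \<Theta> g * sign g * U h = U (g \<otimes> h) + 8 * k"
      using U_mult[of g h] gh unfolding cong_iff_lin by blast
    moreover have "U (g \<otimes> h) = 2 * R (g \<otimes> h)" using gh by (intro UR L.m_closed)
    ultimately have "R g + \<Theta> g * sign g * R h = R (g \<otimes> h) + 4 * k"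
      using UR[OF gh(1)] UR[OF gh(2)] by (simp add: algebra_simps)
    then show ?thesis unfolding cong_iff_lin by blast
  qed
  have odd: "odd (\<Theta> g * sign g)" if "g \<in> L" for g
    using \<Theta>_odd[OF L.mem_carrier[OF that]] odd_sign[of g] unfolding even_mult_iff by blast
  have r_mult: "r (g \<otimes> h) = r g + r h" if "g \<in> L" "h \<in> L" for g h
  proof -
    have "(of_int (\<Theta> g * sign g) :: bit) = 1"
      using odd[OF that(1)] unfolding of_int_bit_eq by (rule if_not_P)
    then show ?thesis
      using of_int_bit_cong[OF cong_dvd_modulus[OF R_mult[OF that], of 2]] by (simp add: r_def)
  qed
  have U_lc: "locally_const T (carrier G) U"
    unfolding U_def using \<Phi>_lc Q_lc \<tau>_lc b_lc \<Theta>_lc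
    by (intro locally_const_comp2[where F = "(+)"] locally_const_comp2[where F = "(-)"]
        locally_const_comp2[where F = "(*)"] locally_const_comp[where F = int_of_bit]
        locally_const_const openin_carrier)
  have R_lc: "locally_const T L R"
    unfolding R_def
    by (rule locally_const_subset[OF locally_const_comp[OF U_lc] L_open L.subset])
  have r_lc: "locally_const T L r" unfolding r_def by (rule locally_const_comp[OF R_lc])
  obtain \<rho> where \<rho>: "locally_const T L \<rho>"
    "\<And>g h. g \<in> L \<Longrightarrow> h \<in> L \<Longrightarrow> r g * r h + \<epsilon> g * r h = \<rho> h + \<rho> (g \<otimes> h) + \<rho> g"
    using bockstein[OF L_subgroup L_open r_lc r_mult] by blast
  have hi_R: "hi (R (g \<otimes> h)) = hi (R g) + hi (R h) + (\<epsilon> g + b g) * r h + r g * r h"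
    if "g \<in> L" "h \<in> L" for g h
    using hi_cocycle[OF R_mult[OF that] odd[OF that(1)]]
    unfolding hi_\<Theta>_sign[OF L.mem_carrier[OF that(1)]] r_def .
  have main: "b g * r h = (hi (R h) + \<rho> h) + (hi (R (g \<otimes> h)) + \<rho> (g \<otimes> h)) + (hi (R g) + \<rho> g)"
    if "g \<in> L" "h \<in> L" for g h
  proof -
    have "(hi (R h) + \<rho> h) + (hi (R (g \<otimes> h)) + \<rho> (g \<otimes> h)) + (hi (R g) + \<rho> g) =
      (hi (R h) + hi (R (g \<otimes> h)) + hi (R g)) + (\<rho> h + \<rho> (g \<otimes> h) + \<rho> g)"
      by (simp only: add_ac)
    also have "\<dots> = b g * r h"
      unfolding \<rho>(2)[OF that, symmetric] hi_R[OF that] by (simp only: bit_ring)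
    finally show ?thesis ..
  qed
  show ?thesis
  proof (intro exI[of _ "\<lambda>g. hi (R g) + \<rho> g"] conjI ballI)
    show "locally_const T L (\<lambda>g. hi (R g) + \<rho> g)"
      by (intro locally_const_bit_arith \<rho>(1) locally_const_comp[OF R_lc])
    show "b g * (I 0 h + hi (Q 0 h) + \<epsilon>' h + \<epsilon> h) =
        (hi (R h) + \<rho> h) + (hi (R (g \<otimes> h)) + \<rho> (g \<otimes> h)) + (hi (R g) + \<rho> g)"
      if "g \<in> L" "h \<in> L" for g h
      using main[OF that] unfolding r[OF that(2)] .
  qed
qed

text \<open>On \<open>L\<close> the factor \<open>q + \<epsilon>\<close> is \<open>b\<close>, so
  \<open>Y\<close> is the sum of the products of \<open>b\<close> with \<open>Z\<close> and of
  \<open>I\<close> with \<open>b\<close>. Up to coboundaries this is the product of \<open>b\<close>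
  with i / sqrt(-q), which \<open>cup_b_vanishes\<close> kills.\<close>

lemma Y_on_L:
  "\<exists>\<mu>. locally_const T L \<mu> \<and> (\<forall>g\<in>L. \<forall>h\<in>L. Y 0 g h = \<mu> h + \<mu> (g \<otimes> h) + \<mu> g)"
proof -
  obtain \<kappa> where \<kappa>: "locally_const T L \<kappa>"
    "\<And>g h. g \<in> L \<Longrightarrow> h \<in> L \<Longrightarrow> b g * (I 0 h + hi (Q 0 h) + \<epsilon>' h + \<epsilon> h) = \<kappa> h + \<kappa> (g \<otimes> h) + \<kappa> g"
    using cup_b_vanishes by blast
  \<comment> \<open>The coboundary of \<open>I 0 g * b g\<close> interchanges the factors in the
    product of \<open>I\<close> and \<open>b\<close>, but \<open>I\<close> is no cocycle and two
    more terms appear. The coboundary of \<open>I 0\<close> cancels one; the other matches the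
    summand \<open>q 0 g * b g\<close> noted at \<open>hi_U\<close>.\<close>
  define \<mu> where "\<mu> g = \<kappa> g + (I 0 g + I 0 g * b g)" for g
  have main: "Y 0 g h = \<mu> h + \<mu> (g \<otimes> h) + \<mu> g" if gh: "g \<in> L" "h \<in> L" for g h
  proof -
    have b: "q 0 k + \<epsilon> k = b k" if "k \<in> L" for k
      using that by (cases "b k"; cases "q 0 k"; cases "\<epsilon> k") auto
    have carrier: "g \<in> carrier G" "h \<in> carrier G" "c g = 0" using gh by auto
    have q: "q 0 h = b h + \<epsilon> h" using b[OF gh(2)] by (simp only: bit_ring flip: b[OF gh(2)])
    have "\<mu> h + \<mu> (g \<otimes> h) + \<mu> g = (\<kappa> h + \<kappa> (g \<otimes> h) + \<kappa> g) +
      ((I 0 h + I 0 h * b h) + (I 0 (g \<otimes> h) + I 0 (g \<otimes> h) * b (g \<otimes> h)) + (I 0 g + I 0 g * b g))"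
      by (simp only: \<mu>_def add_ac)
    also have "\<dots> = Y 0 g h"
      unfolding \<kappa>(2)[OF gh, symmetric] I_mult[OF carrier(1,2)] b_mult[OF carrier(1,2)] Y_def Z_def
        carrier(3) add_0_right q by (simp only: bit_ring)
    finally show ?thesis ..
  qed
  have "locally_const T L (\<lambda>g. I 0 g + I 0 g * b g)"
  proof (rule locally_const_subset[OF _ L_open])
    show "locally_const T (carrier G) (\<lambda>g. I 0 g + I 0 g * b g)"
      by (intro locally_const_bit_arith I_lc b_lc)
  qed (rule subgroup.subset[OF L_subgroup])
  from locally_const_bit_arith(1)[OF \<kappa>(1) this] have lc: "locally_const T L \<mu>" unfolding \<mu>_def .
  show ?thesis by (intro exI[of _ \<mu>] conjI ballI lc main)
qed

text \<open>As \<open>Y 0\<close> vanishes on \<open>L\<close>, the kernel of \<open>w\<close> in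
  \<open>K\<close>, it is a cup product with \<open>w\<close> on \<open>K\<close>. This is where the
  class r arises.\<close>

lemma Y_on_K:
  "\<exists>m r. locally_const T K m \<and> locally_const T K r \<and>
    (\<forall>g\<in>K. \<forall>h\<in>K. r (g \<otimes> h) = r g + r h) \<and>
    (\<forall>g\<in>K. \<forall>h\<in>K. Y 0 g h + w g * r h = m h + m (g \<otimes> h) + m g)"
proof -
  obtain \<mu> where \<mu>: "locally_const T L \<mu>"
    "\<And>g h. g \<in> L \<Longrightarrow> h \<in> L \<Longrightarrow> Y 0 g h = \<mu> h + \<mu> (g \<otimes> h) + \<mu> g"
    using Y_on_L by blast
  show ?thesis
  proof (rule kernel_coboundary[OF K_subgroup w_lc w_mult])
    show "Y 0 h k + Y 0 (g \<otimes> h) k + Y 0 g (h \<otimes> k) + Y 0 g h = 0"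
      if "g \<in> K" "h \<in> K" "k \<in> K" for g h k using Y_cocycle[of g h k 0] that by simp
    show "locally_const T K (\<lambda>g. Y 0 g x)" "locally_const T K (\<lambda>g. Y 0 x g)" for x
      using locally_const_subset[OF Y_lc(1) K_open] locally_const_subset[OF Y_lc(2) K_open] by auto
    show "locally_const T L \<mu>" by (rule \<mu>)
    show "Y 0 g h = \<mu> h + \<mu> (g \<otimes> h) + \<mu> g" if "g \<in> K" "h \<in> K" "w g = 0" "w h = 0" for g h
      using that by (intro \<mu>) auto
  qed
qed


section \<open>Corestriction of the relation from K to N\<close>

definition P :: "bit \<Rightarrow> 'a \<Rightarrow> int" where "P \<beta> g = \<Phi> \<beta> 0 g + \<Phi> \<beta> 1 g"

definition p :: "bit \<Rightarrow> 'a \<Rightarrow> bit" where "p \<beta> g = of_int (P \<beta> g)"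

text \<open>The kernel of the total corestriction of \<open>\<Phi>\<close> modulo 2. There the
  partial corestrictions \<open>p\<close> and \<open>q\<close> lose their dependence on the index
  and become characters.\<close>

abbreviation "N \<equiv> {g \<in> carrier G. q 0 g + q 1 g = 0}"

lemma P_mult:
  assumes "g \<in> carrier G" "h \<in> carrier G"
  shows "[P \<beta> (g \<otimes> h) = P \<beta> g + \<Theta> g * P (\<beta> + b g) h] (mod 8)"
proof -
  have "[P \<beta> (g \<otimes> h) = (\<Phi> \<beta> 0 g + \<Theta> g * \<Phi> (\<beta> + b g) (0 + c g) h) +
      (\<Phi> \<beta> 1 g + \<Theta> g * \<Phi> (\<beta> + b g) (1 + c g) h)] (mod 8)" (is "[_ = ?rhs] (mod 8)")
    unfolding P_def by (intro cong_add \<Phi>_mult assms)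
  also have "?rhs = P \<beta> g + \<Theta> g * P (\<beta> + b g) h"
    by (cases "c g") (simp_all add: P_def algebra_simps)
  finally show ?thesis .
qed

lemma p_q: "p 0 g + p 1 g = q 0 g + q 1 g"
  by (simp add: p_def q_def P_def Q_def add_ac)

lemma q_N: "g \<in> N \<Longrightarrow> q \<gamma> g = q 0 g"
  by (cases \<gamma>; cases "q 0 g"; cases "q 1 g") auto

lemma p_N: "g \<in> N \<Longrightarrow> p \<beta> g = p 0 g"
  using p_q[of g] by (cases \<beta>; cases "p 0 g"; cases "p 1 g") auto

lemma a_mult:
  assumes "g \<in> carrier G" "h \<in> carrier G"
  shows "q 0 (g \<otimes> h) + q 1 (g \<otimes> h) = (q 0 g + q 1 g) + (q 0 h + q 1 h)"
  unfolding q_mult[OF assms] by (cases "c g") (simp_all only: bit_ring bit_add_self)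

lemma N_subgroup: "subgroup N G"
  by (rule kernel_subgroup[OF subgroup_self a_mult])

lemma a_lc: "locally_const T (carrier G) (\<lambda>g. q 0 g + q 1 g)"
  by (intro locally_const_bit_arith q_lc)

lemma N_open: "openin T N"
  using a_lc by (simp add: locally_const_def)

lemma p_mult_N: "g \<in> N \<Longrightarrow> h \<in> N \<Longrightarrow> p 0 (g \<otimes> h) = p 0 g + p 0 h"
proof -
  assume N: "g \<in> N" "h \<in> N"
  then have gh: "g \<in> carrier G" "h \<in> carrier G" by auto
  have "p 0 (g \<otimes> h) = p 0 g + p (0 + b g) h"
    using of_int_bit_cong[OF cong_dvd_modulus[OF P_mult[OF gh, of 0], of 2]] gh
    by (simp add: p_def of_int_\<Theta>)
  then show ?thesis by (simp only: p_N[OF N(2), of "0 + b g"])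
qed

lemma p_lc: "locally_const T (carrier G) (p \<beta>)"
  unfolding p_def P_def
  by (rule locally_const_comp[OF locally_const_comp2[OF \<Phi>_lc \<Phi>_lc]])

text \<open>On N the total corestriction \<open>Q 0 + Q 1\<close> of \<open>\<Phi>\<close> is even, and its half represents sqrt(a): the
  lemma says that sqrt(a) and p have the same cup product with b.\<close>

lemma cup_p:
  "\<exists>\<mu>. locally_const T N \<mu> \<and> (\<forall>g\<in>N. \<forall>h\<in>N.
     b g * (hi (Q 0 h + Q 1 h) + p 0 h) = \<mu> h + \<mu> (g \<otimes> h) + \<mu> g)"
proof -
  interpret N: subgroup N G by (rule N_subgroup)
  obtain \<rho> where \<rho>: "locally_const T N \<rho>"
    "\<And>g h. g \<in> N \<Longrightarrow> h \<in> N \<Longrightarrow> p 0 g * p 0 h + \<epsilon> g * p 0 h = \<rho> h + \<rho> (g \<otimes> h) + \<rho> g"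
    using bockstein[OF N_subgroup N_open locally_const_subset[OF p_lc N_open N.subset] p_mult_N] by blast
  have main: "b g * (hi (Q 0 h + Q 1 h) + p 0 h) =
      (hi (P 0 h) + \<rho> h) + (hi (P 0 (g \<otimes> h)) + \<rho> (g \<otimes> h)) + (hi (P 0 g) + \<rho> g)"
    if gh: "g \<in> N" "h \<in> N" for g h
  proof -
    note carrier = subgroup.mem_carrier[OF N_subgroup gh(1)] subgroup.mem_carrier[OF N_subgroup gh(2)]
    have "[P 0 (g \<otimes> h) = P 0 g + \<Theta> g * P (0 + b g) h] (mod 4)"
      by (rule cong_dvd_modulus[OF P_mult[OF carrier]]) simp
    from hi_cocycle[OF this \<Theta>_odd[OF carrier(1)]]
    have "hi (P 0 (g \<otimes> h)) = hi (P 0 g) + hi (P (0 + b g) h) + \<epsilon> g * p (0 + b g) h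
        + p 0 g * p (0 + b g) h"
      by (simp only: \<epsilon>_def p_def)
    then have *: "hi (P 0 (g \<otimes> h)) = hi (P 0 g) + hi (P (0 + b g) h) + \<epsilon> g * p 0 h + p 0 g * p 0 h"
      by (simp only: p_N[OF gh(2), of "0 + b g"])
    have "Q 0 h + Q 1 h = P 0 h + P 1 h" by (simp add: P_def Q_def)
    then have "hi (Q 0 h + Q 1 h) = hi (P 0 h) + hi (P 1 h) + p 0 h"
      using p_N[OF gh(2), of 1] by (simp only: hi_add flip: p_def) (simp only: bit_ring)
    \<comment> \<open>Passing from \<open>P 0\<close> to \<open>P 1\<close> changes the upper digit
      by that of the total corestriction plus \<open>p 0\<close>, whence the factor
      \<open>b g\<close> in the coboundary of \<open>hi (P 0 g)\<close>.\<close>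
    then have **: "hi (P (0 + b g) h) = hi (P 0 h) + b g * (hi (Q 0 h + Q 1 h) + p 0 h)"
      by (cases "b g") (simp_all add: bit_ring)
    have "(hi (P 0 h) + \<rho> h) + (hi (P 0 (g \<otimes> h)) + \<rho> (g \<otimes> h)) + (hi (P 0 g) + \<rho> g) =
      (hi (P 0 h) + hi (P 0 (g \<otimes> h)) + hi (P 0 g)) + (\<rho> h + \<rho> (g \<otimes> h) + \<rho> g)"
      by (simp only: add_ac)
    also have "\<dots> = b g * (hi (Q 0 h + Q 1 h) + p 0 h)"
      unfolding \<rho>(2)[OF gh, symmetric] * ** by (simp only: bit_ring)
    finally show ?thesis ..
  qed
  have "locally_const T N (\<lambda>g. hi (P 0 g) + \<rho> g)"
  proof (intro locally_const_bit_arith \<rho>(1))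
    have "locally_const T (carrier G) (P 0)" unfolding P_def by (rule locally_const_comp2[OF \<Phi>_lc \<Phi>_lc])
    from locally_const_subset[OF locally_const_comp[OF this] N_open N.subset]
    show "locally_const T N (\<lambda>g. hi (P 0 g))" .
  qed
  then show ?thesis by (intro exI[of _ "\<lambda>g. hi (P 0 g) + \<rho> g"] conjI ballI main)
qed

text \<open>Shapiro's lemma extends the relation on \<open>K\<close> to families over the whole
  group, and adding the two components is the corestriction. On \<open>N\<close> the factors
  \<open>q 0\<close> and \<open>q 1\<close> agree, so the sum consists of products with the
  corestrictions of the other factors.\<close>

lemma transfer:
  assumes t: "t \<in> carrier G" "c t = 1"
  shows "\<exists>X r m. locally_const T (carrier G) X \<and> locally_const T (carrier G) r \<and>
    locally_const T N m \<and>
    (\<forall>g\<in>carrier G. \<forall>h\<in>carrier G. X (g \<otimes> h) = X g + X h) \<and>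
    (\<forall>g\<in>carrier G. \<forall>h\<in>carrier G. r (g \<otimes> h) = r g + r h + c g * X h) \<and>
    (\<forall>g\<in>N. \<forall>h\<in>N. b g * (hi (Q 0 h + Q 1 h) + q 0 h) + p 0 g * (q 0 h + \<epsilon> h) + w g * X h =
      m h + m (g \<otimes> h) + m g)"
proof -
  obtain m0 r0 where m0: "locally_const T K m0" and r0: "locally_const T K r0"
    and r0_mult: "\<forall>g\<in>K. \<forall>h\<in>K. r0 (g \<otimes> h) = r0 g + r0 h"
    and m0_mult: "\<forall>g\<in>K. \<forall>h\<in>K. Y 0 g h + w g * r0 h = m0 h + m0 (g \<otimes> h) + m0 g"
    using Y_on_K by (elim exE conjE)
  \<comment> \<open>For the zero cocycle the lemma in degree 2 becomes Shapiro's lemma in degree 1: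
    the character \<open>r0\<close> of \<open>K\<close> extends to a coinduced cocycle.\<close>
  have "\<exists>r. (\<forall>\<gamma>. locally_const T (carrier G) (r \<gamma>)) \<and>
    (\<forall>\<gamma>. \<forall>g\<in>carrier G. \<forall>h\<in>carrier G. 0 = r (\<gamma> + c g) h + r \<gamma> (g \<otimes> h) + r \<gamma> g) \<and>
    (\<forall>g\<in>carrier G. c g = 0 \<longrightarrow> r 0 g = r0 g)"
  proof (rule shapiro_degree2[OF subgroup_self c_lc c_mult t])
    show "locally_const T (carrier G) (\<lambda>g. 0 :: bit)" by (rule locally_const_const[OF openin_carrier])
    show "0 = r0 h + r0 (g \<otimes> h) + r0 g"
      if "g \<in> carrier G" "h \<in> carrier G" "c g = 0" "c h = 0" for g h
      using r0_mult that by (simp add: bit_ring)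
  qed (simp_all add: r0 locally_const_const openin_carrier)
  then obtain r where r_lc': "\<forall>\<gamma>. locally_const T (carrier G) (r \<gamma>)"
    and r_mult': "\<forall>\<gamma>. \<forall>g\<in>carrier G. \<forall>h\<in>carrier G. 0 = r (\<gamma> + c g) h + r \<gamma> (g \<otimes> h) + r \<gamma> g"
    and r_r0: "\<forall>g\<in>carrier G. c g = 0 \<longrightarrow> r 0 g = r0 g"
    by (elim exE conjE)
  note r_lc = r_lc'[THEN spec]
  have r_mult: "r \<gamma> (g \<otimes> h) = r \<gamma> g + r (\<gamma> + c g) h" if "g \<in> carrier G" "h \<in> carrier G" for \<gamma> g h
  proof -
    have "r \<gamma> (g \<otimes> h) = r \<gamma> g + r (\<gamma> + c g) h + 0"
      using r_mult' that by (intro bit_sum4_eq_0) (simp add: add_ac)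
    then show ?thesis by simp
  qed
  \<comment> \<open>The corestriction of \<open>r0\<close>. As \<open>r 0\<close> and
    \<open>r 1\<close> differ by \<open>X\<close>, the component \<open>r 0\<close> is a primitive
    of the cup product of \<open>c\<close> and \<open>X\<close>.\<close>
  define X where "X g = r 0 g + r 1 g" for g
  have r_shift: "r (\<gamma> + u) g = r \<gamma> g + u * X g" for \<gamma> u g
    by (cases u; cases \<gamma>) (simp_all add: X_def bit_ring)
  have X_mult: "X (g \<otimes> h) = X g + X h" if "g \<in> carrier G" "h \<in> carrier G" for g h
    unfolding X_def r_mult[OF that] r_shift by (simp only: X_def bit_ring)
  \<comment> \<open>The left side of the relation on \<open>K\<close> as a coinduced cochain:
    \<open>c g\<close> shifts the index of the second factor.\<close>
  define W where "W \<gamma> g h = Y \<gamma> g h + (b g + q \<gamma> g + \<epsilon> g) * r (\<gamma> + c g) h" for \<gamma> g h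
  have "\<exists>m. (\<forall>\<gamma>. locally_const T (carrier G) (m \<gamma>)) \<and>
    (\<forall>\<gamma>. \<forall>g\<in>carrier G. \<forall>h\<in>carrier G. W \<gamma> g h = m (\<gamma> + c g) h + m \<gamma> (g \<otimes> h) + m \<gamma> g) \<and>
    (\<forall>g\<in>carrier G. c g = 0 \<longrightarrow> m 0 g = m0 g)"
  proof (rule shapiro_degree2[OF subgroup_self c_lc c_mult t])
    show "W (\<gamma> + c g) h k + W \<gamma> (g \<otimes> h) k + W \<gamma> g (h \<otimes> k) + W \<gamma> g h = 0"
      if "g \<in> carrier G" "h \<in> carrier G" "k \<in> carrier G" for \<gamma> g h k
    proof -
      have "W (\<gamma> + c g) h k + W \<gamma> (g \<otimes> h) k + W \<gamma> g (h \<otimes> k) + W \<gamma> g h =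
        (Y (\<gamma> + c g) h k + Y \<gamma> (g \<otimes> h) k + Y \<gamma> g (h \<otimes> k) + Y \<gamma> g h) +
        ((b h + q (\<gamma> + c g) h + \<epsilon> h) * r (\<gamma> + c g + c h) k +
         (b (g \<otimes> h) + q \<gamma> (g \<otimes> h) + \<epsilon> (g \<otimes> h)) * r (\<gamma> + c (g \<otimes> h)) k +
         (b g + q \<gamma> g + \<epsilon> g) * r (\<gamma> + c g) (h \<otimes> k) +
         (b g + q \<gamma> g + \<epsilon> g) * r (\<gamma> + c g) h)"
        unfolding W_def by (simp only: add_ac)
      also have "\<dots> = 0"
        unfolding Y_cocycle[OF that] c_mult[OF that(1,2)] b_mult[OF that(1,2)] q_mult[OF that(1,2)]
          \<epsilon>_mult[OF that(1,2)] r_mult[OF that(2,3)]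
        by (simp only: bit_ring)
      finally show ?thesis .
    qed
    show "locally_const T (carrier G) (\<lambda>g. W 0 g x)" for x
    proof -
      have "locally_const T (carrier G) (\<lambda>g. Y 0 g x + (b g + q 0 g + \<epsilon> g) * r (0 + c g) x)"
        by (intro locally_const_bit_arith Y_lc b_lc q_lc \<epsilon>_lc
            locally_const_comp[OF c_lc, of "\<lambda>u. r (0 + u) x"])
      then show ?thesis by (simp only: W_def)
    qed
    show "locally_const T (carrier G) (\<lambda>g. W 0 x g)" for x
      unfolding W_def
      by (intro locally_const_bit_arith Y_lc r_lc locally_const_const[OF openin_carrier])
    show "W 0 g h = m0 h + m0 (g \<otimes> h) + m0 g"
      if "g \<in> carrier G" "h \<in> carrier G" "c g = 0" "c h = 0" for g h
      using m0_mult r_r0 that by (simp add: W_def)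
  qed (assumption | rule m0)+
  then obtain m where m_lc': "\<forall>\<gamma>. locally_const T (carrier G) (m \<gamma>)"
    and m': "\<forall>\<gamma>. \<forall>g\<in>carrier G. \<forall>h\<in>carrier G. W \<gamma> g h = m (\<gamma> + c g) h + m \<gamma> (g \<otimes> h) + m \<gamma> g"
    by (elim exE conjE)
  note m_lc = m_lc'[THEN spec] and m = m'[THEN spec, THEN bspec, THEN bspec]
  have N: "b g * (hi (Q 0 h + Q 1 h) + q 0 h) + p 0 g * (q 0 h + \<epsilon> h) + w g * X h =
      (m 0 h + m 1 h) + (m 0 (g \<otimes> h) + m 1 (g \<otimes> h)) + (m 0 g + m 1 g)"
    if gh: "g \<in> N" "h \<in> N" for g h
  proof -
    note carrier = subgroup.mem_carrier[OF N_subgroup gh(1)] subgroup.mem_carrier[OF N_subgroup gh(2)]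
    have "W 0 g h + W 1 g h =
        (m 0 h + m 1 h) + (m 0 (g \<otimes> h) + m 1 (g \<otimes> h)) + (m 0 g + m 1 g)"
      unfolding m[OF carrier] by (cases "c g") (simp_all add: add_ac)
    moreover have "W 0 g h + W 1 g h =
        b g * (Z 0 h + Z 1 h) + (I 0 g + I 1 g) * (q 0 h + \<epsilon> h) + w g * X h"
    proof -
      have Z: "Z (0 + c g) h + Z (1 + c g) h = Z 0 h + Z 1 h" by (cases "c g") (simp_all add: add_ac)
      have "W 0 g h + W 1 g h = b g * (Z (0 + c g) h + Z (1 + c g) h) +
          (I 0 g + I 1 g) * (q 0 h + \<epsilon> h) + w g * X h"
        unfolding W_def Y_def r_shift q_N[OF gh(2), of "0 + c g"] q_N[OF gh(2), of "1 + c g"]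
          q_N[OF gh(1), of 1] by (simp only: X_def bit_ring)
      then show ?thesis by (simp only: Z)
    qed
    \<comment> \<open>On \<open>N\<close> the carry in \<open>Q 0 h + Q 1 h\<close> is
      \<open>q 0 h\<close>, and all summands of \<open>Z 0 h\<close> and \<open>Z 1 h\<close> except
      the upper digits cancel.\<close>
    moreover have "Z 0 h + Z 1 h = hi (Q 0 h + Q 1 h) + q 0 h"
      unfolding Z_def hi_add q_def[symmetric] q_N[OF gh(2), of 1] by (simp only: bit_ring)
    moreover have "I 0 g + I 1 g = p 0 g" by (simp add: I_def p_def P_def)
    ultimately show ?thesis by (simp only:)
  qed
  have r0_mult: "r 0 (g \<otimes> h) = r 0 g + r 0 h + c g * X h" if "g \<in> carrier G" "h \<in> carrier G" for g h
    unfolding r_mult[OF that] r_shift by (simp only: add_ac)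
  show ?thesis
  proof (intro exI conjI ballI)
    show "locally_const T (carrier G) X" unfolding X_def by (intro locally_const_bit_arith r_lc)
    show "locally_const T (carrier G) (r 0)" by (rule r_lc)
    show "locally_const T N (\<lambda>g. m 0 g + m 1 g)"
      by (intro locally_const_bit_arith locally_const_subset[OF m_lc N_open subgroup.subset[OF N_subgroup]])
  qed (assumption | rule X_mult r0_mult N)+
qed

text \<open>The sum of three relations: \<open>transfer\<close>, then \<open>cup_p\<close> to
  replace sqrt(a) by p, and \<open>\<psi>\<close> to remove the product of b and q.\<close>

lemma cup_vanishes_on_N:
  assumes t: "t \<in> carrier G" "c t = 1"
    and \<psi>_lc: "locally_const T N \<psi>"
    and \<psi>: "\<forall>g\<in>N. \<forall>h\<in>N. b g * q 0 h = \<psi> h + \<psi> (g \<otimes> h) + \<psi> g"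
  shows "\<exists>X r \<eta>. locally_const T (carrier G) X \<and> locally_const T (carrier G) r \<and>
    locally_const T N \<eta> \<and>
    (\<forall>g\<in>carrier G. \<forall>h\<in>carrier G. X (g \<otimes> h) = X g + X h) \<and>
    (\<forall>g\<in>carrier G. \<forall>h\<in>carrier G. r (g \<otimes> h) = r g + r h + c g * X h) \<and>
    (\<forall>g\<in>N. \<forall>h\<in>N. (p 0 g + X g) * (q 0 h + b h + \<epsilon> h) = \<eta> h + \<eta> (g \<otimes> h) + \<eta> g)"
proof -
  interpret N: subgroup N G by (rule N_subgroup)
  obtain X r m where X_lc: "locally_const T (carrier G) X" and r_lc: "locally_const T (carrier G) r"
    and m_lc: "locally_const T N m"
    and X: "\<forall>g\<in>carrier G. \<forall>h\<in>carrier G. X (g \<otimes> h) = X g + X h"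
    and r: "\<forall>g\<in>carrier G. \<forall>h\<in>carrier G. r (g \<otimes> h) = r g + r h + c g * X h"
    and m: "\<forall>g\<in>N. \<forall>h\<in>N. b g * (hi (Q 0 h + Q 1 h) + q 0 h) + p 0 g * (q 0 h + \<epsilon> h) + w g * X h =
      m h + m (g \<otimes> h) + m g"
    using transfer[OF t] by (elim exE conjE)
  obtain \<mu> where \<mu>_lc: "locally_const T N \<mu>"
    and \<mu>: "\<forall>g\<in>N. \<forall>h\<in>N. b g * (hi (Q 0 h + Q 1 h) + p 0 h) = \<mu> h + \<mu> (g \<otimes> h) + \<mu> g"
    using cup_p by (elim exE conjE)
  \<comment> \<open>The coboundary of a product of two characters is the sum of their cup products
    in both orders. Thus \<open>\<xi>\<close> moves \<open>b\<close> and \<open>w\<close> into the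
    second factor, where all terms combine to \<open>q 0 + b + \<epsilon>\<close>.\<close>
  define \<xi> where "\<xi> g = b g * p 0 g + w g * X g" for g
  define \<eta> where "\<eta> g = m g + \<mu> g + \<psi> g + \<xi> g" for g
  have main: "(p 0 g + X g) * (q 0 h + b h + \<epsilon> h) = \<eta> h + \<eta> (g \<otimes> h) + \<eta> g"
    if gh: "g \<in> N" "h \<in> N" for g h
  proof -
    note carrier = subgroup.mem_carrier[OF N_subgroup gh(1)] subgroup.mem_carrier[OF N_subgroup gh(2)]
    have "q 0 (g \<otimes> h) = q 0 g + q 0 h"
      unfolding q_mult[OF carrier] by (simp only: q_N[OF gh(2), of "0 + c g"])
    then have "\<xi> h + \<xi> (g \<otimes> h) + \<xi> g =
        b g * p 0 h + p 0 g * b h + w g * X h + X g * w h"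
      by (simp only: \<xi>_def b_mult[OF carrier] p_mult_N[OF gh] \<epsilon>_mult[OF carrier]
          X[THEN bspec, THEN bspec, OF carrier] bit_ring)
    moreover have "\<eta> h + \<eta> (g \<otimes> h) + \<eta> g = (m h + m (g \<otimes> h) + m g) +
        (\<mu> h + \<mu> (g \<otimes> h) + \<mu> g) + (\<psi> h + \<psi> (g \<otimes> h) + \<psi> g) + (\<xi> h + \<xi> (g \<otimes> h) + \<xi> g)"
      by (simp only: \<eta>_def add_ac)
    ultimately show ?thesis
      unfolding m[THEN bspec, THEN bspec, OF gh, symmetric] \<mu>[THEN bspec, THEN bspec, OF gh, symmetric]
        \<psi>[THEN bspec, THEN bspec, OF gh, symmetric]
      by (simp only: bit_ring)
  qed
  have lc: "locally_const T N f" if "locally_const T (carrier G) f" for f :: "'a \<Rightarrow> bit"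
    using that N_open N.subset by (rule locally_const_subset)
  show ?thesis
  proof (intro exI conjI ballI)
    show "locally_const T N \<eta>" unfolding \<eta>_def \<xi>_def
      by (intro locally_const_bit_arith m_lc \<mu>_lc \<psi>_lc lc b_lc p_lc q_lc \<epsilon>_lc X_lc)
  qed (assumption | rule X_lc r_lc main X[THEN bspec, THEN bspec] r[THEN bspec, THEN bspec])+
qed

end

section \<open>The Massey product\<close>

lemma d1_eq_iff: "d1 G f g h = s \<longleftrightarrow> f (g \<otimes>\<^bsub>G\<^esub> h) = f g + f h + s"
  unfolding d1_def by (cases "f (g \<otimes>\<^bsub>G\<^esub> h)"; cases "f g"; cases "f h"; cases s) simp_all

lemma massey_defined_quadrupleD:
  assumes "massey_defined G T [x1, x2, x3, x4]" and T: "topspace T = carrier G"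
  obtains A13 A24 A35 A14 A25 where
    "locally_const T (carrier G) A13" "locally_const T (carrier G) A24"
    "locally_const T (carrier G) A35" "locally_const T (carrier G) A14"
    "locally_const T (carrier G) A25"
    "\<And>g h. g \<in> carrier G \<Longrightarrow> h \<in> carrier G \<Longrightarrow>
      A13 (g \<otimes>\<^bsub>G\<^esub> h) = A13 g + A13 h + x1 g * x2 h"
    "\<And>g h. g \<in> carrier G \<Longrightarrow> h \<in> carrier G \<Longrightarrow>
      A24 (g \<otimes>\<^bsub>G\<^esub> h) = A24 g + A24 h + x2 g * x3 h"
    "\<And>g h. g \<in> carrier G \<Longrightarrow> h \<in> carrier G \<Longrightarrow>
      A35 (g \<otimes>\<^bsub>G\<^esub> h) = A35 g + A35 h + x3 g * x4 h"
    "\<And>g h. g \<in> carrier G \<Longrightarrow> h \<in> carrier G \<Longrightarrow>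
      A14 (g \<otimes>\<^bsub>G\<^esub> h) = A14 g + A14 h + (x1 g * A24 h + A13 g * x3 h)"
    "\<And>g h. g \<in> carrier G \<Longrightarrow> h \<in> carrier G \<Longrightarrow>
      A25 (g \<otimes>\<^bsub>G\<^esub> h) = A25 g + A25 h + (x2 g * A35 h + A24 g * x4 h)"
proof -
  obtain A where A: "massey_defining_system G T [x1, x2, x3, x4] A"
    using assms(1) by (auto simp: massey_defined_def)
  note A = A[unfolded massey_defining_system_def, rule_format]
  have lc: "locally_const T (carrier G) (A 1 3)" "locally_const T (carrier G) (A 2 4)"
    "locally_const T (carrier G) (A 3 5)" "locally_const T (carrier G) (A 1 4)"
    "locally_const T (carrier G) (A 2 5)"
    using A[of 1 3] A[of 2 4] A[of 3 5] A[of 1 4] A[of 2 5]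
    by (simp_all add: cochain1_iff T)
  \<comment> \<open>Coboundaries of 0-cochains vanish for the trivial action, so the entries next to
    the diagonal are the given characters themselves.\<close>
  have x: "A 1 2 g = x1 g" "A 2 3 g = x2 g" "A 3 4 g = x3 g" "A 4 5 g = x4 g" if "g \<in> carrier G" for g
    using A[of 1 2] A[of 2 3] A[of 3 4] A[of 4 5] that
    by (simp_all add: d0_def bit_add_eq_0)
  have sets: "{Suc (Suc 0)..2} = {2::nat}" "{Suc 2..3} = {3::nat}" "{Suc 3..4} = {4::nat}"
    "{Suc (Suc 0)..3} = {2, 3::nat}" "{3..4} = {3, 4::nat}"
    by auto
  show ?thesis
  proof (rule that[OF lc])
    fix g h
    assume gh: "g \<in> carrier G" "h \<in> carrier G"
    note d = A[THEN conjunct2, THEN conjunct2, rule_format, OF _ _ gh]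
    show "A 1 3 (g \<otimes>\<^bsub>G\<^esub> h) = A 1 3 g + A 1 3 h + x1 g * x2 h"
      using d[of 1 3] x gh by (simp add: d1_eq_iff cup11_def sets)
    show "A 2 4 (g \<otimes>\<^bsub>G\<^esub> h) = A 2 4 g + A 2 4 h + x2 g * x3 h"
      using d[of 2 4] x gh by (simp add: d1_eq_iff cup11_def sets)
    show "A 3 5 (g \<otimes>\<^bsub>G\<^esub> h) = A 3 5 g + A 3 5 h + x3 g * x4 h"
      using d[of 3 5] x gh by (simp add: d1_eq_iff cup11_def sets)
    show "A 1 4 (g \<otimes>\<^bsub>G\<^esub> h) = A 1 4 g + A 1 4 h + (x1 g * A 2 4 h + A 1 3 g * x3 h)"
      using d[of 1 4] x gh by (simp add: d1_eq_iff cup11_def sets)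
    show "A 2 5 (g \<otimes>\<^bsub>G\<^esub> h) = A 2 5 g + A 2 5 h + (x2 g * A 3 5 h + A 2 4 g * x4 h)"
      using d[of 2 5] x gh by (simp add: d1_eq_iff cup11_def sets)
  qed
qed

lemma massey_vanishes_quadrupleI:
  assumes T: "topspace T = carrier G"
    and x: "cocycle1 G T x1" "cocycle1 G T x2" "cocycle1 G T x3" "cocycle1 G T x4"
    and lc: "locally_const T (carrier G) A13" "locally_const T (carrier G) A24"
    "locally_const T (carrier G) A35" "locally_const T (carrier G) A14"
    "locally_const T (carrier G) A25" "locally_const T (carrier G) m"
    and A: "\<And>g h. g \<in> carrier G \<Longrightarrow> h \<in> carrier G \<Longrightarrow>
      A13 (g \<otimes>\<^bsub>G\<^esub> h) = A13 g + A13 h + x1 g * x2 h"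
    "\<And>g h. g \<in> carrier G \<Longrightarrow> h \<in> carrier G \<Longrightarrow>
      A24 (g \<otimes>\<^bsub>G\<^esub> h) = A24 g + A24 h + x2 g * x3 h"
    "\<And>g h. g \<in> carrier G \<Longrightarrow> h \<in> carrier G \<Longrightarrow>
      A35 (g \<otimes>\<^bsub>G\<^esub> h) = A35 g + A35 h + x3 g * x4 h"
    "\<And>g h. g \<in> carrier G \<Longrightarrow> h \<in> carrier G \<Longrightarrow>
      A14 (g \<otimes>\<^bsub>G\<^esub> h) = A14 g + A14 h + (x1 g * A24 h + A13 g * x3 h)"
    "\<And>g h. g \<in> carrier G \<Longrightarrow> h \<in> carrier G \<Longrightarrow>
      A25 (g \<otimes>\<^bsub>G\<^esub> h) = A25 g + A25 h + (x2 g * A35 h + A24 g * x4 h)"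
    and V: "\<And>g h. g \<in> carrier G \<Longrightarrow> h \<in> carrier G \<Longrightarrow>
      x1 g * A25 h + A13 g * A35 h + A14 g * x4 h = m h + m (g \<otimes>\<^bsub>G\<^esub> h) + m g"
  shows "massey_vanishes G T [x1, x2, x3, x4]"
proof -
  \<comment> \<open>The last branch is meant for (2, 5); pairs outside the defining system receive
    the same value.\<close>
  define A where "A i j =
    (if (i, j) = (1, 2) then x1 else if (i, j) = (2, 3) then x2
     else if (i, j) = (3, 4) then x3 else if (i, j) = (4, 5) then x4
     else if (i, j) = (1, 3) then A13 else if (i, j) = (2, 4) then A24
     else if (i, j) = (3, 5) then A35 else if (i, j) = (1, 4) then A14 else A25)" for i j :: nat
  have sets: "{Suc (Suc 0)..2} = {2::nat}" "{Suc 2..3} = {3::nat}" "{Suc 3..4} = {4::nat}"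
    "{Suc (Suc 0)..3} = {2, 3::nat}" "{3..4} = {3, 4::nat}" "{2..4} = {2, 3, 4::nat}"
    by auto
  have "massey_defining_system G T [x1, x2, x3, x4] A"
    unfolding massey_defining_system_def
  proof (intro allI impI)
    fix i j :: nat
    assume "1 \<le> i \<and> i < j \<and> j \<le> length [x1, x2, x3, x4] + 1 \<and>
      (i, j) \<noteq> (1, length [x1, x2, x3, x4] + 1)"
    then have ij: "1 \<le> i" "i < j" "j \<le> 5" "i = 1 \<Longrightarrow> j \<noteq> 5" by auto
    have "i = 1 \<or> i = 2 \<or> i = 3 \<or> i = 4" "j = 2 \<or> j = 3 \<or> j = 4 \<or> j = 5"
      using ij(1-3) by arith+
    with ij consider "i = 1" "j = 2" | "i = 2" "j = 3" | "i = 3" "j = 4" | "i = 4" "j = 5"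
      | "i = 1" "j = 3" | "i = 2" "j = 4" | "i = 3" "j = 5" | "i = 1" "j = 4" | "i = 2" "j = 5"
      by (elim disjE) simp_all
    then show "cochain1 T (A i j) \<and>
      (j = Suc i \<longrightarrow> (\<forall>g\<in>carrier G. \<forall>h\<in>carrier G. d1 G (A i j) g h = 0) \<and>
        (\<exists>c. \<forall>g\<in>carrier G. A i j g - ([x1, x2, x3, x4] ! (i - 1)) g = d0 c g)) \<and>
      (Suc i < j \<longrightarrow> (\<forall>g\<in>carrier G. \<forall>h\<in>carrier G.
        d1 G (A i j) g h = - (\<Sum>l\<in>{i+1..j-1}. cup11 (A i l) (A l j) g h)))"
      using x lc A
      by cases (simp_all add: A_def cocycle1_def cochain1_iff T d0_def d1_eq_iff cup11_def sets)
  qed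
  moreover have "massey_value (length [x1, x2, x3, x4]) A g h = d1 G m g h"
    if "g \<in> carrier G" "h \<in> carrier G" for g h
  proof -
    have "massey_value (length [x1, x2, x3, x4]) A g h =
        x1 g * A25 h + A13 g * A35 h + A14 g * x4 h"
      by (simp add: massey_value_def cup11_def A_def sets add_ac)
    then show ?thesis by (simp add: V[OF that] d1_def bit_minus)
  qed
  ultimately show ?thesis
    unfolding massey_vanishes_def using lc(6)
    by (intro exI[of _ A] conjI exI[of _ m] ballI) (simp_all add: cochain1_iff T)
qed

section \<open>Modification of the defining system\<close>

context kummer_group
begin

lemma quadruple_massey_vanishes:
  fixes a b c A13 A24 A35 A14 A25 :: "'a \<Rightarrow> bit"
  assumes cocycles: "cocycle1 G T a" "cocycle1 G T b" "cocycle1 G T c"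
    and A_lc: "locally_const T (carrier G) A13"
      "locally_const T (carrier G) A24" "locally_const T (carrier G) A35"
      "locally_const T (carrier G) A14" "locally_const T (carrier G) A25"
    and A13: "\<And>g h. g \<in> carrier G \<Longrightarrow> h \<in> carrier G \<Longrightarrow> A13 (g \<otimes> h) = A13 g + A13 h + a g * b h"
    and A24: "\<And>g h. g \<in> carrier G \<Longrightarrow> h \<in> carrier G \<Longrightarrow> A24 (g \<otimes> h) = A24 g + A24 h + b g * c h"
    and A35: "\<And>g h. g \<in> carrier G \<Longrightarrow> h \<in> carrier G \<Longrightarrow> A35 (g \<otimes> h) = A35 g + A35 h + c g * a h"
    and A14: "\<And>g h. g \<in> carrier G \<Longrightarrow> h \<in> carrier G \<Longrightarrow>
      A14 (g \<otimes> h) = A14 g + A14 h + (a g * A24 h + A13 g * c h)"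
    and A25: "\<And>g h. g \<in> carrier G \<Longrightarrow> h \<in> carrier G \<Longrightarrow>
      A25 (g \<otimes> h) = A25 g + A25 h + (b g * A35 h + A24 g * a h)"
    and t: "t \<in> carrier G" "c t = 1"
  shows "massey_vanishes G T [a, b, c, a]"
proof -
  have lc: "locally_const T (carrier G) a" "locally_const T (carrier G) b"
    "locally_const T (carrier G) c"
    using cocycles by (auto simp: cocycle1_def cochain1_iff topspace)
  have a: "a (g \<otimes> h) = a g + a h" and b: "b (g \<otimes> h) = b g + b h" and c: "c (g \<otimes> h) = c g + c h"
    if "g \<in> carrier G" "h \<in> carrier G" for g h
    using cocycles that by (auto simp: cocycle1_def d1_eq_iff)
  \<comment> \<open>Adding \<open>a g * b g\<close> interchanges the factors: \<open>p\<close> is a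
    primitive of the cup product of \<open>b\<close> and \<open>a\<close>, the order needed for a
    cocycle coinduced from the kernel of \<open>b\<close>.\<close>
  define p where "p g = A13 g + a g * b g" for g
  \<comment> \<open>The Jacobi identity: \<open>A14\<close> and \<open>A25\<close> are primitives
    for the triple products of a, b, c and of b, c, a, and the corrections turn their sum into a
    component of a coinduced cocycle.\<close>
  define i where "i g = A14 g + A25 g + A24 g * a g + p g * c g" for g
  \<comment> \<open>Indexed by the values of \<open>(b, c)\<close>. Summing over the first index,
    starting from 0, leaves \<open>A35\<close> as partial corestriction, summing over the second
    leaves \<open>p\<close>, and the sum of all four components is \<open>a\<close>.\<close>
  define \<phi> where "\<phi> v g = i g + fst v * A35 g + snd v * p g + fst v * snd v * a g" for v :: "bit \<times> bit" and g
  define w where "w g = (b g, c g)" for g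
  have p: "p (g \<otimes> h) = p g + p h + b g * a h" if "g \<in> carrier G" "h \<in> carrier G" for g h
    by (simp only: p_def A13[OF that] a[OF that] b[OF that] bit_ring)
  have i: "i (g \<otimes> h) = i g + i h + c g * p h + b g * A35 h + b g * c g * a h"
    if "g \<in> carrier G" "h \<in> carrier G" for g h
    unfolding i_def p[OF that] A14[OF that] A25[OF that] A24[OF that] a[OF that] c[OF that]
    by (simp only: p_def bit_ring)
  have \<phi>: "\<phi> v (g \<otimes> h) = \<phi> v g + \<phi> (v + w g) h" if "g \<in> carrier G" "h \<in> carrier G" for v g h
    unfolding \<phi>_def i[OF that] p[OF that] A35[OF that] a[OF that] w_def
    by (simp only: fst_add snd_add fst_conv snd_conv bit_ring)
  have w: "w (g \<otimes> h) = w g + w h" if "g \<in> carrier G" "h \<in> carrier G" for g h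
    by (simp add: w_def b[OF that] c[OF that])
  have w_lc: "locally_const T (carrier G) w"
    unfolding w_def by (rule locally_const_comp2[OF lc(2,3)])
  have p_lc: "locally_const T (carrier G) p"
    unfolding p_def by (intro locally_const_bit_arith lc A_lc)
  have i_lc: "locally_const T (carrier G) i"
    unfolding i_def by (intro locally_const_bit_arith lc A_lc p_lc)
  have \<phi>_lc: "locally_const T (carrier G) (\<phi> v)" for v
    unfolding \<phi>_def by (intro locally_const_bit_arith lc A_lc p_lc i_lc locally_const_const openin_carrier)
  let ?B = "{g \<in> carrier G. w g = 0}"
  have B_subgroup: "subgroup ?B G" by (rule kernel_subgroup[OF subgroup_self w])
  have B_open: "openin T ?B" using locally_const_openin[OF w_lc, of "\<lambda>u. u = 0"] .
  have "\<exists>f. locally_const T ?B f \<and> (\<forall>g\<in>?B. of_int (f g) = \<phi> v g) \<and>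
      (\<forall>g\<in>?B. \<forall>h\<in>?B. [f (g \<otimes> h) = f g + \<Theta> g * f h] (mod 8))" for v
  proof (rule lift[OF B_subgroup B_open])
    show "locally_const T ?B (\<phi> v)"
      by (rule locally_const_subset[OF \<phi>_lc B_open]) auto
    show "\<phi> v (g \<otimes> h) = \<phi> v g + \<phi> v h" if "g \<in> ?B" "h \<in> ?B" for g h
      using \<phi>[of g h v] that by simp
  qed
  from choice[OF allI, OF this]
  obtain f where f: "\<forall>v. locally_const T ?B (f v) \<and> (\<forall>g\<in>?B. of_int (f v g) = \<phi> v g) \<and>
      (\<forall>g\<in>?B. \<forall>h\<in>?B. [f v (g \<otimes> h) = f v g + \<Theta> g * f v h] (mod 8))" ..
  have "\<exists>\<Phi>. (\<forall>v. locally_const T (carrier G) (\<Phi> v)) \<and>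
    (\<forall>v. \<forall>g\<in>carrier G. \<forall>h\<in>carrier G. [\<Phi> v (g \<otimes> h) = \<Phi> v g + \<Theta> g * \<Phi> (v + w g) h] (mod 8)) \<and>
    (\<forall>v. \<forall>g\<in>carrier G. of_int (\<Phi> v g) = \<phi> v g)"
    by (rule shapiro_lift[OF w_lc w \<Theta>_lc \<Theta>_mult8 \<Theta>_sq _ _ _ \<phi>]) (use f in auto)
  then obtain \<Phi> where \<Phi>_lc: "\<forall>v. locally_const T (carrier G) (\<Phi> v)"
    and \<Phi>_mult: "\<forall>v. \<forall>g\<in>carrier G. \<forall>h\<in>carrier G.
      [\<Phi> v (g \<otimes> h) = \<Phi> v g + \<Theta> g * \<Phi> (v + w g) h] (mod 8)"
    and \<Phi>: "\<forall>v. \<forall>g\<in>carrier G. of_int (\<Phi> v g) = \<phi> v g"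
    by (elim exE conjE)
  interpret F: massey_family G T \<Theta> b c "\<lambda>\<beta> \<gamma>. \<Phi> (\<beta>, \<gamma>)"
  proof unfold_locales
    show "[\<Phi> (\<beta>, \<gamma>) (g \<otimes> h) = \<Phi> (\<beta>, \<gamma>) g + \<Theta> g * \<Phi> (\<beta> + b g, \<gamma> + c g) h] (mod 8)"
      if "g \<in> carrier G" "h \<in> carrier G" for g h \<beta> \<gamma>
      using \<Phi>_mult that by (simp add: w_def)
  qed (use lc b c \<Phi>_lc in auto)
  have F: "F.q 0 g = A35 g" "F.q 0 g + F.q 1 g = a g" "F.p 0 g = p g" if "g \<in> carrier G" for g
    using \<Phi> that by (simp_all add: F.q_def F.Q_def F.p_def F.P_def \<phi>_def bit_ring)
  have N: "F.N = {g \<in> carrier G. a g = 0}" using F(2) by auto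
  have A25_lc: "locally_const T F.N A25"
    by (rule locally_const_subset[OF A_lc(5) F.N_open subgroup.subset[OF F.N_subgroup]])
  \<comment> \<open>On the kernel of \<open>a\<close> the term \<open>A24 g * a h\<close> drops out
    of the coboundary of \<open>A25\<close>.\<close>
  have A25_N: "\<forall>g\<in>F.N. \<forall>h\<in>F.N. b g * F.q 0 h = A25 h + A25 (g \<otimes> h) + A25 g"
    unfolding N by (simp add: F A25 bit_ring)
  obtain X r \<eta> where X_lc: "locally_const T (carrier G) X" and r_lc: "locally_const T (carrier G) r"
    and \<eta>_lc: "locally_const T F.N \<eta>"
    and X: "\<forall>g\<in>carrier G. \<forall>h\<in>carrier G. X (g \<otimes> h) = X g + X h"
    and r: "\<forall>g\<in>carrier G. \<forall>h\<in>carrier G. r (g \<otimes> h) = r g + r h + c g * X h"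
    and \<eta>: "\<forall>g\<in>F.N. \<forall>h\<in>F.N. (F.p 0 g + X g) * (F.q 0 h + b h + \<epsilon> h) = \<eta> h + \<eta> (g \<otimes> h) + \<eta> g"
    using F.cup_vanishes_on_N[OF t A25_lc A25_N] by (elim exE conjE)
  note X' = X[THEN bspec, THEN bspec] and r' = r[THEN bspec, THEN bspec]
  \<comment> \<open>Changing \<open>A35\<close> by \<open>b + \<epsilon>\<close> requires that the
    product of \<open>b\<close> with \<open>b + \<epsilon>\<close> vanish, which is the Bockstein
    relation for \<open>b\<close>.\<close>
  obtain \<kappa> where \<kappa>_lc: "locally_const T (carrier G) \<kappa>"
    and \<kappa>: "\<forall>g\<in>carrier G. \<forall>h\<in>carrier G. b g * b h + \<epsilon> g * b h = \<kappa> h + \<kappa> (g \<otimes> h) + \<kappa> g"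
    using bockstein[OF subgroup_self openin_carrier lc(2) b] by blast
  \<comment> \<open>In \<open>B14\<close> the sum of \<open>r\<close> and \<open>c g * X g\<close>
    is a primitive of the product of \<open>X\<close> and \<open>c\<close>, the second summand
    reversing the factors; in \<open>B25\<close>, \<open>\<kappa>\<close> and
    \<open>b g * \<epsilon> g\<close> play the same parts for \<open>b\<close> and
    \<open>b + \<epsilon>\<close>.\<close>
  define B13 where "B13 g = A13 g + X g" for g
  define B35 where "B35 g = A35 g + b g + \<epsilon> g" for g
  define B14 where "B14 g = A14 g + r g + c g * X g" for g
  define B25 where "B25 g = A25 g + \<kappa> g + b g * \<epsilon> g" for g
  have B13: "B13 (g \<otimes> h) = B13 g + B13 h + a g * b h" if "g \<in> carrier G" "h \<in> carrier G" for g h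
    by (simp only: B13_def A13[OF that] X'[OF that] bit_ring)
  have B35: "B35 (g \<otimes> h) = B35 g + B35 h + c g * a h" if "g \<in> carrier G" "h \<in> carrier G" for g h
    by (simp only: B35_def A35[OF that] b[OF that] \<epsilon>_mult[OF that] bit_ring)
  have B14: "B14 (g \<otimes> h) = B14 g + B14 h + (a g * A24 h + B13 g * c h)"
    if "g \<in> carrier G" "h \<in> carrier G" for g h
    by (simp only: B14_def B13_def A14[OF that] r'[OF that] c[OF that] X'[OF that] bit_ring)
  have B25: "B25 (g \<otimes> h) = B25 g + B25 h + (b g * B35 h + A24 g * a h)"
    if "g \<in> carrier G" "h \<in> carrier G" for g h
  proof -
    have "\<kappa> (g \<otimes> h) = \<kappa> h + \<kappa> g + (b g * b h + \<epsilon> g * b h)"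
      by (rule bit_cancel) (use \<kappa> that in simp)
    then show ?thesis
      by (simp only: B25_def B35_def A25[OF that] b[OF that] \<epsilon>_mult[OF that] bit_ring)
  qed
  have B_lc: "locally_const T (carrier G) B13" "locally_const T (carrier G) B35"
    "locally_const T (carrier G) B14" "locally_const T (carrier G) B25"
    unfolding B13_def B35_def B14_def B25_def
    by (intro locally_const_bit_arith lc A_lc X_lc r_lc \<kappa>_lc \<epsilon>_lc)+
  define V where "V g h = a g * B25 h + B13 g * B35 h + B14 g * a h" for g h
  \<comment> \<open>The new value is a coboundary on the kernel of \<open>a\<close>, hence a cup
    product of \<open>a\<close> with a character \<open>e\<close> up to coboundaries. Adding
    \<open>e\<close> to \<open>B25\<close> preserves the defining system and cancels this
    product.\<close>
  have "\<exists>m e. locally_const T (carrier G) m \<and> locally_const T (carrier G) e \<and>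
    (\<forall>g\<in>carrier G. \<forall>h\<in>carrier G. e (g \<otimes> h) = e g + e h) \<and>
    (\<forall>g\<in>carrier G. \<forall>h\<in>carrier G. V g h + a g * e h = m h + m (g \<otimes> h) + m g)"
  proof (rule kernel_coboundary[OF subgroup_self lc(1) a])
    show "V h k + V (g \<otimes> h) k + V g (h \<otimes> k) + V g h = 0"
      if "g \<in> carrier G" "h \<in> carrier G" "k \<in> carrier G" for g h k
      unfolding V_def a[OF that(1,2)] B13[OF that(1,2)] B14[OF that(1,2)] B25[OF that(2,3)]
        B35[OF that(2,3)] a[OF that(2,3)]
      by (simp only: bit_ring)
    show "locally_const T (carrier G) (\<lambda>g. V g x)" "locally_const T (carrier G) (\<lambda>g. V x g)" for x
      unfolding V_def
      by (intro locally_const_bit_arith lc B_lc locally_const_const[OF openin_carrier])+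
    show "locally_const T {g \<in> carrier G. a g = 0} \<eta>" using \<eta>_lc unfolding N .
    show "V g h = \<eta> h + \<eta> (g \<otimes> h) + \<eta> g"
      if gh: "g \<in> carrier G" "h \<in> carrier G" "a g = 0" "a h = 0" for g h
    proof -
      have "V g h = (F.p 0 g + X g) * (F.q 0 h + b h + \<epsilon> h)"
        by (simp add: V_def gh F B13_def B35_def p_def)
      also have "\<dots> = \<eta> h + \<eta> (g \<otimes> h) + \<eta> g" using gh by (intro \<eta>[THEN bspec, THEN bspec]) (simp_all add: N)
      finally show ?thesis .
    qed
  qed
  then obtain m e where m_lc: "locally_const T (carrier G) m" and e_lc: "locally_const T (carrier G) e"
    and e: "\<forall>g\<in>carrier G. \<forall>h\<in>carrier G. e (g \<otimes> h) = e g + e h"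
    and m: "\<forall>g\<in>carrier G. \<forall>h\<in>carrier G. V g h + a g * e h = m h + m (g \<otimes> h) + m g"
    by (elim exE conjE)
  have B25': "B25 (g \<otimes> h) + e (g \<otimes> h) = (B25 g + e g) + (B25 h + e h) + (b g * B35 h + A24 g * a h)"
    if "g \<in> carrier G" "h \<in> carrier G" for g h
    unfolding B25[OF that] e[THEN bspec, THEN bspec, OF that] by (simp only: add_ac)
  have V: "a g * (B25 h + e h) + B13 g * B35 h + B14 g * a h = m h + m (g \<otimes> h) + m g"
    if "g \<in> carrier G" "h \<in> carrier G" for g h
    unfolding m[THEN bspec, THEN bspec, OF that, symmetric] V_def by (simp only: bit_ring)
  have B25'_lc: "locally_const T (carrier G) (\<lambda>g. B25 g + e g)"
    by (intro locally_const_bit_arith B_lc e_lc)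
  show ?thesis
    by (rule massey_vanishes_quadrupleI[OF topspace cocycles cocycles(1) B_lc(1) A_lc(2) B_lc(2,3)
        B25'_lc m_lc]) (assumption | rule B13 A24 B35 B14 B25' V)+
qed

end

section \<open>From formal Hilbert 90 to lifts modulo 8\<close>

lemma formal_hilbert90_kummer_group:
  assumes G: "profinite_group G T" and \<theta>: "p_orientation 2 G T \<theta>"
    and hilbert90: "formal_hilbert90 2 G T \<theta>"
  shows "kummer_group G T (\<lambda>g. \<theta> g 4)"
proof -
  interpret top_group G T
    using G by (simp add: profinite_group_def top_group_def top_group_axioms_def)
  have unit: "zp_unit 2 (\<theta> g)" if "g \<in> carrier G" for g
    using \<theta> that by (simp add: p_orientation_def)
  have red: "\<theta> g (Suc n) mod 2 ^ n = \<theta> g n" if "g \<in> carrier G" for g n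
    using unit[OF that] by (simp add: zp_unit_def)
  have red3: "[\<theta> g 3 = \<theta> g 4] (mod 8)" if "g \<in> carrier G" for g
    using red[OF that, of 3] by (auto simp: cong_def numeral_eq_Suc)
  have odd1: "odd (\<theta> g 1)" if "g \<in> carrier G" for g
    using unit[OF that] by (simp add: zp_unit_def)
  have one: "\<theta> g 1 = 1" if "g \<in> carrier G" for g
  proof -
    have "0 \<le> \<theta> g 1 \<and> \<theta> g 1 < 2 ^ 1" using unit[OF that] unfolding zp_unit_def by blast
    then show ?thesis using odd1[OF that] by (cases "\<theta> g 1 = 0") auto
  qed
  show ?thesis
  proof
    show "locally_const T (carrier G) (\<lambda>g. \<theta> g 4)"
      using \<theta> by (simp add: p_orientation_def locally_const_def)
    show "odd (\<theta> g 4)" if "g \<in> carrier G" for g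
    proof -
      have "\<theta> g 4 mod 8 = \<theta> g 3" "\<theta> g 3 mod 4 = \<theta> g 2" "\<theta> g 2 mod 2 = \<theta> g 1"
        using red[OF that, of 3] red[OF that, of 2] red[OF that, of 1] by (simp_all add: numeral_eq_Suc)
      then show ?thesis using one[OF that] by presburger
    qed
    show "[\<theta> (g \<otimes>\<^bsub>G\<^esub> h) 4 = \<theta> g 4 * \<theta> h 4] (mod 16)" if "g \<in> carrier G" "h \<in> carrier G" for g h
      using \<theta> that by (simp add: p_orientation_def cong_def)
    show "\<exists>c. locally_const T H c \<and> (\<forall>g\<in>H. of_int (c g) = f g) \<and>
        (\<forall>g\<in>H. \<forall>h\<in>H. [c (g \<otimes>\<^bsub>G\<^esub> h) = c g + \<theta> g 4 * c h] (mod 8))"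
      if H: "subgroup H G" "openin T H" and f_lc: "locally_const T H f"
        and f: "\<And>g h. g \<in> H \<Longrightarrow> h \<in> H \<Longrightarrow> f (g \<otimes>\<^bsub>G\<^esub> h) = f g + f h" for H and f :: "'a \<Rightarrow> bit"
    proof -
      have carrier: "g \<in> carrier G" if "g \<in> H" for g using subgroup.mem_carrier[OF H(1) that] .
      have "tw_cocycle1 2 G T \<theta> H 1 (\<lambda>g. int_of_bit (f g))"
        unfolding tw_cocycle1_def
      proof (intro conjI ballI allI)
        show "openin T {h \<in> H. int_of_bit (f h) = v}" for v
          using locally_const_openin[OF f_lc, of "\<lambda>u. int_of_bit u = v"] .
        show "int_of_bit (f (g \<otimes>\<^bsub>G\<^esub> h)) = (int_of_bit (f g) + \<theta> g 1 * int_of_bit (f h)) mod 2 ^ 1"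
          if "g \<in> H" "h \<in> H" for g h
          unfolding f[OF that] one[OF carrier[OF that(1)]]
          by (cases "f g"; cases "f h") (simp_all add: int_of_bit_def)
      qed (simp_all add: int_of_bit_def)
      then obtain c where c: "tw_cocycle1 2 G T \<theta> H 3 c"
        and cf: "tw_cohomologous1 2 \<theta> H 1 (\<lambda>h. c h mod 2) (\<lambda>g. int_of_bit (f g))"
        using hilbert90 H unfolding formal_hilbert90_def
        by (metis one_le_numeral)
      \<comment> \<open>Since \<open>\<theta>\<close> is 1 modulo 2, coboundaries in Z/2(1) are
        zero, and the cohomologous reduction equals \<open>f\<close>.\<close>
      have "of_int (c g) = f g" if g: "g \<in> H" for g
      proof -
        have "[c g = int_of_bit (f g)] (mod 2)"
          using cf g one[OF carrier[OF g]] by (auto simp: tw_cohomologous1_def cong_def)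
        from of_int_bit_cong[OF this] show ?thesis by simp
      qed
      moreover have "[c (g \<otimes>\<^bsub>G\<^esub> h) = c g + \<theta> g 4 * c h] (mod 8)" if "g \<in> H" "h \<in> H" for g h
      proof -
        have "[c (g \<otimes>\<^bsub>G\<^esub> h) = c g + \<theta> g 3 * c h] (mod 8)"
          using c that by (simp add: tw_cocycle1_def cong_def)
        moreover have "[c g + \<theta> g 3 * c h = c g + \<theta> g 4 * c h] (mod 8)"
          by (intro cong_add cong_refl cong_mult[OF red3[OF carrier[OF that(1)]]])
        ultimately show ?thesis by (rule cong_trans)
      qed
      ultimately show ?thesis
        using c by (intro exI[of _ c]) (auto simp: tw_cocycle1_def locally_const_def)
    qed
  qed
qed

theorem theorem1p4:
  fixes G :: "('a, 'b) monoid_scheme" and T :: "'a topology"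
    and \<theta> :: "'a \<Rightarrow> nat \<Rightarrow> int" and \<chi>1 \<chi>2 \<chi>3 :: "'a \<Rightarrow> bit"
  assumes "profinite_group G T"
    and "p_orientation 2 G T \<theta>"
    and "formal_hilbert90 2 G T \<theta>"
    and "cocycle1 G T \<chi>1" and "cocycle1 G T \<chi>2" and "cocycle1 G T \<chi>3"
    and "massey_defined G T [\<chi>1, \<chi>2, \<chi>3, \<chi>1]"
  shows "massey_vanishes G T [\<chi>1, \<chi>2, \<chi>3, \<chi>1]"
proof -
  interpret kummer_group G T "\<lambda>g. \<theta> g 4"
    by (rule formal_hilbert90_kummer_group[OF assms(1-3)])
  obtain A13 A24 A35 A14 A25 where A_lc: "locally_const T (carrier G) A13"
    "locally_const T (carrier G) A24" "locally_const T (carrier G) A35"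
    "locally_const T (carrier G) A14" "locally_const T (carrier G) A25"
    and A: "\<And>g h. g \<in> carrier G \<Longrightarrow> h \<in> carrier G \<Longrightarrow>
      A13 (g \<otimes>\<^bsub>G\<^esub> h) = A13 g + A13 h + \<chi>1 g * \<chi>2 h"
    "\<And>g h. g \<in> carrier G \<Longrightarrow> h \<in> carrier G \<Longrightarrow>
      A24 (g \<otimes>\<^bsub>G\<^esub> h) = A24 g + A24 h + \<chi>2 g * \<chi>3 h"
    "\<And>g h. g \<in> carrier G \<Longrightarrow> h \<in> carrier G \<Longrightarrow>
      A35 (g \<otimes>\<^bsub>G\<^esub> h) = A35 g + A35 h + \<chi>3 g * \<chi>1 h"
    "\<And>g h. g \<in> carrier G \<Longrightarrow> h \<in> carrier G \<Longrightarrow>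
      A14 (g \<otimes>\<^bsub>G\<^esub> h) = A14 g + A14 h + (\<chi>1 g * A24 h + A13 g * \<chi>3 h)"
    "\<And>g h. g \<in> carrier G \<Longrightarrow> h \<in> carrier G \<Longrightarrow>
      A25 (g \<otimes>\<^bsub>G\<^esub> h) = A25 g + A25 h + (\<chi>2 g * A35 h + A24 g * \<chi>1 h)"
    by (rule massey_defined_quadrupleD[OF assms(7) topspace]) blast
  show ?thesis
  proof (cases "\<exists>t\<in>carrier G. \<chi>3 t = 1")
    case True
    then obtain t where t: "t \<in> carrier G" "\<chi>3 t = 1" by blast
    show ?thesis
      by (rule quadruple_massey_vanishes[OF assms(4-6) A_lc _ _ _ _ _ t]) (assumption | rule A)+
  next
    case False
    then have zero: "\<chi>3 g = 0" if "g \<in> carrier G" for g using that by (cases "\<chi>3 g") auto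
    \<comment> \<open>If \<open>\<chi>3\<close> vanishes, so do all products that involve it, and
      \<open>A13\<close> together with zero entries is a defining system of value 0.\<close>
    have lc0: "locally_const T (carrier G) (\<lambda>_. 0 :: bit)"
      by (rule locally_const_const[OF openin_carrier])
    show ?thesis
      by (rule massey_vanishes_quadrupleI[OF topspace assms(4,5,6,4)
          A_lc(1) lc0 lc0 lc0 lc0 lc0]) (simp_all add: A zero)
  qed
qed

end
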